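(* Let $n\in\mathbb{N}_0=\{0,1,2,\dots\}$, let $\nu$ be real, and let $J_\nu^{(n)}$ denote the $n$th derivative (with respect to the argument) of the Bessel function of the first kind $J_\nu$. The following assertions are valid. (a) If $\nu>n-1$, then $x\mapsto J_\nu^{(n)}(x)$ has infinitely many zeros, which are all real and simple, except the origin (i.e. the simplicity assertion does not concern the origin). (b) If $\nu\ge n$, then the positive zeros of $J_\nu^{(n)}$ and of $J_\nu^{(n+1)}$ are interlacing. (c) If $\nu>n-1$, then all zeros of $x\mapsto (n-\nu)J_\nu^{(n)}(x)+xJ_\nu^{(n+1)}(x)$ are real and interlace with the zeros of $x\mapsto J_\nu^{(n)}(x)$.
   Context: The Bessel function of the first kind is $J_\nu(x)=\sum_{m\ge 0}\frac{(-1)^m}{m!\,\Gamma(\nu+m+1)}\left(\frac{x}{2}\right)^{2m+\nu}$. Convention on zeros: "all zeros" refers to zeros in the complex plane. For $\nu>n-1$ the function $$\mathbb{J}_{\nu,n}(x)=2^{\nu}\Gamma(\nu+1-n)\,x^{n-\nu}J_\nu^{(n)}(x)=\sum_{m\ge0}\frac{(-1)^m\,\Gamma(\nu+2m+1)\,\Gamma(\nu+1-n)}{m!\,2^{2m}\,\Gamma(\nu+2m-n+1)\,\Gamma(\nu+m+1)}\,x^{2m}$$ is an even real entire function. Since $J_\nu^{(n)}$ itself may be multivalued because of the factor $x^{\nu-n}$, its nonzero complex zeros are understood as the zeros of $\mathbb{J}_{\nu,n}$. In (c), the zeros of $x\mapsto (n-\nu)J_\nu^{(n)}(x)+xJ_\nu^{(n+1)}(x)$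 are understood as the zeros of the entire function $x\mapsto x^{n-\nu-1}\left[(n-\nu)J_\nu^{(n)}(x)+xJ_\nu^{(n+1)}(x)\right]$, and the zeros of $J_\nu^{(n)}$ as those of $\mathbb{J}_{\nu,n}$ (so a zero at the origin that comes only from the power factor is disregarded in the interlacing statement). Two discrete sets of real numbers interlace if they are disjoint and between any two consecutive elements of either set there is exactly one element of the other set. *)

theory Defs
  imports "HOL-Complex_Analysis.Complex_Analysis"
begin

text \<open>
  For non-integer order this is the principal branch, holomorphic off the cut
  \<^term>\<open>\<real>\<^sub>\<le>\<^sub>0 :: complex set\<close>. Poles of \<^const>\<open>Gamma\<close> contribute zero terms, since there
  \<^const>\<open>Gamma\<close> is 0 and division by 0 gives 0. Because \<open>0 powr a = 0\<close>, the value at the origin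
  carries no meaning; below, the function is only used off the cut.
\<close>

definition bessel_J :: "real \<Rightarrow> complex \<Rightarrow> complex" where
  "bessel_J \<nu> z =
     (\<Sum>m. (-1) ^ m / (fact m * Gamma (of_real \<nu> + of_nat m + 1)) *
          (z / 2) powr (of_nat (2 * m) + of_real \<nu>))"

definition bessel_J_deriv :: "nat \<Rightarrow> real \<Rightarrow> complex \<Rightarrow> complex" where
  "bessel_J_deriv n \<nu> = (deriv ^^ n) (bessel_J \<nu>)"

text \<open>
  The entire function that coincides with \<open>g\<close> off the cut of the principal branch. It is unique
  (\<open>entire_extension_eqI\<close>), and it exists for the two functions it is applied to below
  (\<open>bessel_JJ_welldefined\<close>, \<open>bessel_LL_welldefined\<close>). Zeros of possibly multivalued functions
  such as the derivatives of \<^const>\<open>bessel_J\<close> are counted through it, once the power of \<open>z\<close>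
  has been removed; for \<open>\<nu> > n - 1\<close> the first
  function has value 1 at the origin, whereas the second always vanishes there.
\<close>

definition entire_extension :: "(complex \<Rightarrow> complex) \<Rightarrow> complex \<Rightarrow> complex" where
  "entire_extension g = (THE F. F holomorphic_on UNIV \<and> (\<forall>z. z \<notin> \<real>\<^sub>\<le>\<^sub>0 \<longrightarrow> F z = g z))"

definition bessel_JJ :: "real \<Rightarrow> nat \<Rightarrow> complex \<Rightarrow> complex" where
  "bessel_JJ \<nu> n = entire_extension
     (\<lambda>z. 2 powr of_real \<nu> * Gamma (of_real \<nu> + 1 - of_nat n) *
          z powr (of_nat n - of_real \<nu>) * bessel_J_deriv n \<nu> z)"

definition bessel_LL :: "real \<Rightarrow> nat \<Rightarrow> complex \<Rightarrow> complex" where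
  "bessel_LL \<nu> n = entire_extension
     (\<lambda>z. z powr (of_nat n - of_real \<nu> - 1) *
          ((of_nat n - of_real \<nu>) * bessel_J_deriv n \<nu> z + z * bessel_J_deriv (Suc n) \<nu> z))"

definition one_between :: "real set \<Rightarrow> real set \<Rightarrow> bool" where
  "one_between A B \<longleftrightarrow>
     (\<forall>a\<in>A. \<forall>b\<in>A. a < b \<and> A \<inter> {a<..<b} = {} \<longrightarrow> (\<exists>!c. c \<in> B \<and> a < c \<and> c < b))"

definition interlace :: "real set \<Rightarrow> real set \<Rightarrow> bool" where
  "interlace A B \<longleftrightarrow>
     discrete A \<and> discrete B \<and> A \<inter> B = {} \<and> one_between A B \<and> one_between B A"


lemma entire_extension_eqI:
  assumes F: "F holomorphic_on UNIV" and eq: "\<And>z. z \<notin> \<real>\<^sub>\<le>\<^sub>0 \<Longrightarrow> F z = g z"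
  shows "entire_extension g = F"
  unfolding entire_extension_def
proof (rule the_equality)
  show "F holomorphic_on UNIV \<and> (\<forall>z. z \<notin> \<real>\<^sub>\<le>\<^sub>0 \<longrightarrow> F z = g z)" using F eq by blast
next
  fix H assume H: "H holomorphic_on UNIV \<and> (\<forall>z. z \<notin> \<real>\<^sub>\<le>\<^sub>0 \<longrightarrow> H z = g z)"
  have op: "open (- \<real>\<^sub>\<le>\<^sub>0 :: complex set)"
    using closed_nonpos_Reals_complex by (rule open_Compl)
  have ne: "(- \<real>\<^sub>\<le>\<^sub>0 :: complex set) \<noteq> {}"
  proof -
    have "(1::complex) \<in> - \<real>\<^sub>\<le>\<^sub>0" by (simp add: complex_nonpos_Reals_iff)
    thus ?thesis by blast
  qed
  show "H = F"
  proof
    fix z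
    show "H z = F z"
      by (rule analytic_continuation_open[OF op open_UNIV ne connected_UNIV subset_UNIV])
         (use H F eq in auto)
  qed
qed

lemma powr_series_deriv:
  fixes b :: "nat \<Rightarrow> complex" and \<mu> :: complex
  assumes sm: "\<And>w. summable (\<lambda>m. b m * w ^ m)"
  shows "summable (\<lambda>m. (\<mu> + of_nat (2 * m)) * b m * w ^ m)"
    and "z \<notin> \<real>\<^sub>\<le>\<^sub>0 \<Longrightarrow> ((\<lambda>z. z powr \<mu> * (\<Sum>m. b m * (z ^ 2) ^ m)) has_field_derivative
           z powr (\<mu> - 1) * (\<Sum>m. (\<mu> + of_nat (2 * m)) * b m * (z ^ 2) ^ m)) (at z)"
proof -
  have sd: "summable (\<lambda>m. diffs b m * w ^ m)" for w
    by (rule termdiff_converges_all[OF sm])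
  have D: "((\<lambda>w. \<Sum>m. b m * w ^ m) has_field_derivative (\<Sum>m. diffs b m * w ^ m)) (at w)" for w
    by (rule termdiffs_strong_converges_everywhere[OF sm])
  have s1: "(\<lambda>m. of_nat m * b m * w ^ m) sums (w * (\<Sum>m. diffs b m * w ^ m))" for w
  proof -
    have "(\<lambda>m. w * (of_nat m * b m * w ^ (m - Suc 0))) sums (w * (\<Sum>m. diffs b m * w ^ m))"
      by (intro sums_mult diffs_equiv sd)
    moreover have "w * (of_nat m * b m * w ^ (m - Suc 0)) = of_nat m * b m * w ^ m" for m
      by (cases m) auto
    ultimately show ?thesis by simp
  qed
  have s2: "(\<lambda>m. (\<mu> + of_nat (2 * m)) * b m * w ^ m) sums
      (\<mu> * (\<Sum>m. b m * w ^ m) + 2 * (w * (\<Sum>m. diffs b m * w ^ m)))" for w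
    using sums_add[OF sums_mult[OF summable_sums[OF sm, of w], of \<mu>] sums_mult[OF s1, of 2 w]]
    by (simp add: algebra_simps)
  show "summable (\<lambda>m. (\<mu> + of_nat (2 * m)) * b m * w ^ m)"
    using s2 by (rule sums_summable)
  assume z: "z \<notin> \<real>\<^sub>\<le>\<^sub>0"
  hence z0: "z \<noteq> 0" by auto
  have "((\<lambda>z. z powr \<mu> * (\<Sum>m. b m * (z ^ 2) ^ m)) has_field_derivative
     (\<mu> * z powr (\<mu> - 1)) * (\<Sum>m. b m * (z ^ 2) ^ m) +
     ((\<Sum>m. diffs b m * (z ^ 2) ^ m) * (2 * z)) * z powr \<mu>) (at z)"
    by (rule DERIV_mult[OF has_field_derivative_powr[OF z] DERIV_chain2[OF D]])
       (auto intro!: derivative_eq_intros)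
  also have "(\<mu> * z powr (\<mu> - 1)) * (\<Sum>m. b m * (z ^ 2) ^ m) +
     ((\<Sum>m. diffs b m * (z ^ 2) ^ m) * (2 * z)) * z powr \<mu> =
     z powr (\<mu> - 1) * (\<mu> * (\<Sum>m. b m * (z^2) ^ m) + 2 * (z^2 * (\<Sum>m. diffs b m * (z^2) ^ m)))"
  proof -
    have "z powr \<mu> = z powr (\<mu> - 1) * z"
      using z0 by (simp add: powr_diff)
    thus ?thesis by (simp add: algebra_simps power2_eq_square)
  qed
  also have "\<dots> = z powr (\<mu> - 1) * (\<Sum>m. (\<mu> + of_nat (2 * m)) * b m * (z ^ 2) ^ m)"
    by (subst sums_unique[OF s2]) simp
  finally show "((\<lambda>z. z powr \<mu> * (\<Sum>m. b m * (z ^ 2) ^ m)) has_field_derivative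
           z powr (\<mu> - 1) * (\<Sum>m. (\<mu> + of_nat (2 * m)) * b m * (z ^ 2) ^ m)) (at z)" .
qed

definition bessel_coeff :: "real \<Rightarrow> nat \<Rightarrow> nat \<Rightarrow> complex" where
  "bessel_coeff \<nu> n m =
     (\<Prod>k<n. of_real \<nu> - of_nat k + of_nat (2 * m)) *
     ((-1) ^ m / (fact m * Gamma (of_real \<nu> + of_nat m + 1)) / 4 ^ m)"

lemma summable_bessel_coeff: "summable (\<lambda>m. bessel_coeff \<nu> n m * w ^ m)"
proof (induction n arbitrary: w)
  case 0
  obtain N where N: "real N \<ge> norm w + \<bar>\<nu>\<bar> + 1" using real_arch_simple by blast
  show ?case
  proof (rule summable_ratio_test[of "1/2" N])
    fix m assume m: "m \<ge> N"
    define x where "x = complex_of_real \<nu> + of_nat m + 1"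
    have xr: "x = of_real (\<nu> + real m + 1)" by (simp add: x_def)
    have nx: "norm x \<ge> 1"
      unfolding xr norm_of_real using m N norm_ge_zero[of w] by linarith
    have x0: "x \<noteq> 0" using nx by auto
    have G: "inverse (Gamma (of_real \<nu> + of_nat (Suc m) + 1)) = inverse (Gamma x) / x"
    proof -
      have *: "of_real \<nu> + of_nat (Suc m) + 1 = x + 1" by (simp add: x_def)
      have "x * rGamma (x + 1) = rGamma x" by (rule rGamma_plus1)
      thus ?thesis
        unfolding * rGamma_inverse_Gamma[symmetric]
        by (metis x0 nonzero_mult_div_cancel_left)
    qed
    have "bessel_coeff \<nu> 0 (Suc m) * w ^ Suc m =
          (bessel_coeff \<nu> 0 m * w ^ m) * (- w / (4 * of_nat (Suc m) * x))"
    proof -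
      have "bessel_coeff \<nu> 0 k = (-1) ^ k * inverse (fact k) *
          inverse (Gamma (of_real \<nu> + of_nat k + 1)) * inverse (4 ^ k)" for k
        by (simp add: bessel_coeff_def divide_inverse)
      note this[of m, folded x_def] this[of "Suc m", unfolded G]
      moreover have "inverse (fact (Suc m) :: complex) = inverse (of_nat (Suc m)) * inverse (fact m)"
        by (simp only: fact_Suc inverse_mult_distrib of_nat_id)
      ultimately show ?thesis
        by (simp only: divide_inverse inverse_mult_distrib power_Suc mult_minus_left
              mult_minus_right mult_1_left mult_1_right mult_ac)
    qed
    hence eq: "norm (bessel_coeff \<nu> 0 (Suc m) * w ^ Suc m) =
          norm (bessel_coeff \<nu> 0 m * w ^ m) * (norm w / (4 * real (Suc m) * norm x))"
      by (simp only: norm_mult norm_divide norm_minus_cancel norm_of_nat norm_numeral)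
    have le: "norm w / (4 * real (Suc m) * norm x) \<le> 1 / 2"
    proof -
      have "norm w \<le> real (Suc m) * 1" using m N by simp
      also have "\<dots> \<le> real (Suc m) * norm x" using nx by (intro mult_left_mono) auto
      finally have "norm w \<le> real (Suc m) * norm x" .
      moreover have "real (Suc m) * norm x > 0" using x0 by simp
      ultimately have "norm w \<le> 1 / 2 * (4 * (real (Suc m) * norm x))"
        and "4 * (real (Suc m) * norm x) > 0" by linarith+
      thus ?thesis by (simp only: pos_divide_le_eq mult.assoc)
    qed
    show "norm (bessel_coeff \<nu> 0 (Suc m) * w ^ Suc m) \<le>
        1 / 2 * norm (bessel_coeff \<nu> 0 m * w ^ m)"
      unfolding eq
      by (subst mult.commute[of "1 / 2"]) (rule mult_left_mono[OF le norm_ge_zero])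
  qed simp
next
  case (Suc n)
  show ?case
    using powr_series_deriv(1)[OF Suc.IH, of "of_real \<nu> - of_nat n" w]
    by (simp add: bessel_coeff_def mult_ac)
qed

lemma bessel_J_deriv_series:
  assumes "z \<notin> \<real>\<^sub>\<le>\<^sub>0"
  shows "bessel_J_deriv n \<nu> z =
    z powr (of_real \<nu> - of_nat n) * (\<Sum>m. bessel_coeff \<nu> n m * (z ^ 2) ^ m) / 2 powr of_real \<nu>"
  using assms
proof (induction n arbitrary: z)
  case 0
  hence z0: "z \<noteq> 0" by auto
  have "Ln (z / 2) = Ln z - Ln 2"
    using Ln_divide_of_real[of 2 z] z0 by (simp add: Ln_of_real[of 2, symmetric])
  hence p: "(z / 2) powr a = z powr a / 2 powr a" for a
    using z0 by (simp add: powr_def ring_distribs exp_diff)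
  have e: "(z / 2) powr (of_nat (2 * m) + of_real \<nu>) =
      z powr of_real \<nu> / 2 powr of_real \<nu> * ((z ^ 2) ^ m / 4 ^ m)" for m
  proof -
    have "(z / 2) powr of_nat (2 * m) = (z / 2) ^ (2 * m)"
      using z0 by (subst powr_nat') auto
    also have "\<dots> = (z ^ 2) ^ m / 4 ^ m" by (simp add: power_mult power_divide)
    finally show ?thesis
      unfolding powr_add p[of "of_real \<nu>"] by (simp only: mult.commute)
  qed
  have "bessel_J \<nu> z =
    (\<Sum>m. z powr of_real \<nu> / 2 powr of_real \<nu> * (bessel_coeff \<nu> 0 m * (z ^ 2) ^ m))"
    unfolding bessel_J_def e by (simp add: bessel_coeff_def mult_ac)
  also have "\<dots> = z powr of_real \<nu> / 2 powr of_real \<nu> * (\<Sum>m. bessel_coeff \<nu> 0 m * (z ^ 2) ^ m)"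
    by (rule suminf_mult[OF summable_bessel_coeff])
  finally show ?case by (simp add: bessel_J_deriv_def)
next
  case (Suc n)
  let ?f = "\<lambda>z. z powr (of_real \<nu> - of_nat n) * (\<Sum>m. bessel_coeff \<nu> n m * (z ^ 2) ^ m) /
                2 powr of_real \<nu>"
  have op: "open (- \<real>\<^sub>\<le>\<^sub>0 :: complex set)"
    using closed_nonpos_Reals_complex by (rule open_Compl)
  have ev: "\<forall>\<^sub>F u in nhds z. bessel_J_deriv n \<nu> u = ?f u"
    by (rule eventually_mono[OF eventually_nhds_in_open[OF op]])
       (use Suc.prems Suc.IH in auto)
  have co: "((of_real \<nu> - of_nat n) + of_nat (2 * m)) * bessel_coeff \<nu> n m = bessel_coeff \<nu> (Suc n) m"
    for m by (simp add: bessel_coeff_def mult_ac)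
  have "bessel_J_deriv (Suc n) \<nu> z = deriv (bessel_J_deriv n \<nu>) z"
    by (simp add: bessel_J_deriv_def)
  also have "\<dots> = deriv ?f z" by (rule deriv_cong_ev[OF ev refl])
  also have "\<dots> = z powr (of_real \<nu> - of_nat n - 1) *
       (\<Sum>m. ((of_real \<nu> - of_nat n) + of_nat (2 * m)) * bessel_coeff \<nu> n m * (z ^ 2) ^ m) /
       2 powr of_real \<nu>"
    by (intro DERIV_imp_deriv DERIV_cdivide powr_series_deriv(2) summable_bessel_coeff Suc.prems)
  also have "\<dots> = z powr (of_real \<nu> - of_nat (Suc n)) *
       (\<Sum>m. bessel_coeff \<nu> (Suc n) m * (z ^ 2) ^ m) / 2 powr of_real \<nu>"
    unfolding co by (simp add: algebra_simps)
  finally show ?case .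
qed

lemma holomorphic_bessel_coeff_series:
  "(\<lambda>z. \<Sum>m. bessel_coeff \<nu> n m * (z ^ 2) ^ m) holomorphic_on UNIV"
proof -
  have "(\<lambda>w. \<Sum>m. bessel_coeff \<nu> n m * w ^ m) holomorphic_on UNIV"
    unfolding holomorphic_on_open[OF open_UNIV]
    using termdiffs_strong_converges_everywhere[OF summable_bessel_coeff] by blast
  hence "((\<lambda>w. \<Sum>m. bessel_coeff \<nu> n m * w ^ m) \<circ> (\<lambda>z. z ^ 2)) holomorphic_on UNIV"
    by (intro holomorphic_on_compose_gen[where t = UNIV]) (auto intro: holomorphic_intros)
  thus ?thesis by (simp add: o_def)
qed

lemma bessel_JJ_eq:
  "bessel_JJ \<nu> n =
     (\<lambda>z. Gamma (of_real \<nu> + 1 - of_nat n) * (\<Sum>m. bessel_coeff \<nu> n m * (z ^ 2) ^ m))"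
  unfolding bessel_JJ_def
proof (rule entire_extension_eqI)
  show "(\<lambda>z. Gamma (of_real \<nu> + 1 - of_nat n) * (\<Sum>m. bessel_coeff \<nu> n m * (z ^ 2) ^ m))
      holomorphic_on UNIV"
    by (intro holomorphic_intros holomorphic_bessel_coeff_series)
next
  fix z :: complex assume z: "z \<notin> \<real>\<^sub>\<le>\<^sub>0"
  hence z0: "z \<noteq> 0" by auto
  have "z powr (of_nat n - of_real \<nu>) * z powr (of_real \<nu> - of_nat n) = 1"
    using z0 by (simp add: powr_add[symmetric])
  thus "Gamma (of_real \<nu> + 1 - of_nat n) * (\<Sum>m. bessel_coeff \<nu> n m * (z ^ 2) ^ m) =
      2 powr of_real \<nu> * Gamma (of_real \<nu> + 1 - of_nat n) *
          z powr (of_nat n - of_real \<nu>) * bessel_J_deriv n \<nu> z"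
    by (simp add: bessel_J_deriv_series[OF z] mult_ac)
qed

theorem bessel_JJ_welldefined:
  shows "bessel_JJ \<nu> n holomorphic_on UNIV"
    and "z \<notin> \<real>\<^sub>\<le>\<^sub>0 \<Longrightarrow> bessel_JJ \<nu> n z =
       2 powr of_real \<nu> * Gamma (of_real \<nu> + 1 - of_nat n) *
          z powr (of_nat n - of_real \<nu>) * bessel_J_deriv n \<nu> z"
proof -
  show "bessel_JJ \<nu> n holomorphic_on UNIV"
    unfolding bessel_JJ_eq by (intro holomorphic_intros holomorphic_bessel_coeff_series)
  assume z: "z \<notin> \<real>\<^sub>\<le>\<^sub>0"
  hence z0: "z \<noteq> 0" by auto
  have "z powr (of_nat n - of_real \<nu>) * z powr (of_real \<nu> - of_nat n) = 1"
    using z0 by (simp add: powr_add[symmetric])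
  thus "bessel_JJ \<nu> n z = 2 powr of_real \<nu> * Gamma (of_real \<nu> + 1 - of_nat n) *
          z powr (of_nat n - of_real \<nu>) * bessel_J_deriv n \<nu> z"
    by (simp add: bessel_JJ_eq bessel_J_deriv_series[OF z] mult_ac)
qed

theorem bessel_JJ_series:
  assumes "\<nu> > real n - 1"
  shows "bessel_JJ \<nu> n z =
    (\<Sum>m. (-1) ^ m * of_real (Gamma (\<nu> + 2 * real m + 1) * Gamma (\<nu> + 1 - real n)) /
         (fact m * 2 ^ (2 * m) *
            of_real (Gamma (\<nu> + 2 * real m - real n + 1) * Gamma (\<nu> + real m + 1))) *
         z ^ (2 * m))"
proof -
  have P: "(\<Prod>k<j. \<nu> - real k + real (2 * m)) =
      Gamma (\<nu> + 2 * real m + 1) / Gamma (\<nu> + 2 * real m - real j + 1)" if "j \<le> n" for j m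
    using that
  proof (induction j)
    case 0
    have "Gamma (\<nu> + 2 * real m + 1) > 0" using assms by (intro Gamma_real_pos) linarith
    thus ?case by simp
  next
    case (Suc j)
    have pos: "\<nu> + 2 * real m - real j > 0"
      using assms Suc.prems by linarith
    have "Gamma (\<nu> + 2 * real m - real j + 1) =
        (\<nu> + 2 * real m - real j) * Gamma (\<nu> + 2 * real m - real j)"
      by (rule Gamma_plus1) (use pos in \<open>auto dest: nonpos_Ints_nonpos\<close>)
    moreover have "\<nu> - real j + real (2 * m) = \<nu> + 2 * real m - real j" by simp
    moreover have "\<nu> + 2 * real m - real (Suc j) + 1 = \<nu> + 2 * real m - real j" by simp
    ultimately show ?case using Suc.IH Suc.prems pos
      by (simp only: prod.lessThan_Suc) simp
  qed
  have t: "Gamma (of_real \<nu> + 1 - of_nat n) * (bessel_coeff \<nu> n m * (z ^ 2) ^ m) =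
    (-1) ^ m * of_real (Gamma (\<nu> + 2 * real m + 1) * Gamma (\<nu> + 1 - real n)) /
         (fact m * 2 ^ (2 * m) *
            of_real (Gamma (\<nu> + 2 * real m - real n + 1) * Gamma (\<nu> + real m + 1))) *
         z ^ (2 * m)" for m
  proof -
    have 1: "Gamma (of_real \<nu> + 1 - of_nat n) = complex_of_real (Gamma (\<nu> + 1 - real n))"
      unfolding Gamma_complex_of_real[symmetric] by simp
    have 2: "Gamma (of_real \<nu> + of_nat m + 1) = complex_of_real (Gamma (\<nu> + real m + 1))"
      unfolding Gamma_complex_of_real[symmetric] by simp
    have 3: "(\<Prod>k<n. complex_of_real \<nu> - of_nat k + of_nat (2 * m)) = 
       of_real (Gamma (\<nu> + 2 * real m + 1) / Gamma (\<nu> + 2 * real m - real n + 1))"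
      unfolding P[OF order_refl, symmetric] by simp
    show ?thesis
      unfolding bessel_coeff_def 1 2 3 power_mult by (simp add: mult_ac)
  qed
  show ?thesis
    unfolding bessel_JJ_eq suminf_mult[OF summable_bessel_coeff, symmetric] t ..
qed

theorem bessel_LL_welldefined:
  shows "bessel_LL \<nu> n holomorphic_on UNIV"
    and "z \<notin> \<real>\<^sub>\<le>\<^sub>0 \<Longrightarrow> bessel_LL \<nu> n z =
      z powr (of_nat n - of_real \<nu> - 1) *
          ((of_nat n - of_real \<nu>) * bessel_J_deriv n \<nu> z + z * bessel_J_deriv (Suc n) \<nu> z)"
proof -
  define S where "S n z = (\<Sum>m. bessel_coeff \<nu> n m * (z ^ 2) ^ m)" for n z
  define B where "B w = (\<Sum>m. bessel_coeff \<nu> n m * w ^ m)" for w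
  define F where "F z = 2 * z * deriv B (z ^ 2) / 2 powr of_real \<nu>" for z
  have BD: "(B has_field_derivative (\<Sum>m. diffs (bessel_coeff \<nu> n) m * w ^ m)) (at w)" for w
    unfolding B_def by (rule termdiffs_strong_converges_everywhere[OF summable_bessel_coeff])
  have Bh: "B holomorphic_on UNIV"
    unfolding holomorphic_on_open[OF open_UNIV] using BD by blast
  have dBh: "(\<lambda>z. deriv B (z ^ 2)) holomorphic_on UNIV"
  proof -
    have "(deriv B \<circ> (\<lambda>z. z ^ 2)) holomorphic_on UNIV"
      by (intro holomorphic_on_compose_gen[where t = UNIV] holomorphic_deriv[OF Bh])
         (auto intro: holomorphic_intros)
    thus ?thesis by (simp add: o_def)
  qed
  have Fh: "F holomorphic_on UNIV"
    unfolding F_def by (intro holomorphic_intros dBh) auto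
  have co: "((of_real \<nu> - of_nat n) + of_nat (2 * m)) * bessel_coeff \<nu> n m = bessel_coeff \<nu> (Suc n) m"
    for m by (simp add: bessel_coeff_def mult_ac)
  have eq: "F z = z powr (of_nat n - of_real \<nu> - 1) *
          ((of_nat n - of_real \<nu>) * bessel_J_deriv n \<nu> z + z * bessel_J_deriv (Suc n) \<nu> z)"
    if z: "z \<notin> \<real>\<^sub>\<le>\<^sub>0" for z
  proof -
    let ?\<mu> = "of_real \<nu> - of_nat n :: complex"
    have z0: "z \<noteq> 0" using z by auto
    have d1: "((\<lambda>z. z powr ?\<mu> * B (z ^ 2)) has_field_derivative z powr (?\<mu> - 1) * S (Suc n) z) (at z)"
      using powr_series_deriv(2)[OF summable_bessel_coeff z, of ?\<mu> \<nu> n]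
      unfolding B_def S_def co .
    have B': "(B has_field_derivative deriv B w) (at w)" for w
      using BD DERIV_imp_deriv by metis
    have d2: "((\<lambda>z. z powr ?\<mu> * B (z ^ 2)) has_field_derivative
        (?\<mu> * z powr (?\<mu> - 1)) * B (z ^ 2) + (deriv B (z ^ 2) * (2 * z)) * z powr ?\<mu>) (at z)"
      by (rule DERIV_mult[OF has_field_derivative_powr[OF z] DERIV_chain2[OF B']])
         (auto intro!: derivative_eq_intros)
    have pz: "z powr ?\<mu> = z powr (?\<mu> - 1) * z"
      using z0 by (simp add: powr_diff)
    have "z powr (?\<mu> - 1) * S (Suc n) z =
        z powr (?\<mu> - 1) * (?\<mu> * S n z + 2 * z * deriv B (z ^ 2) * z)"
      using DERIV_unique[OF d1 d2] unfolding pz B_def S_def by (simp add: algebra_simps)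
    hence S: "S (Suc n) z = ?\<mu> * S n z + 2 * z * deriv B (z ^ 2) * z"
      using z0 by simp
    have inv: "z powr (of_nat n - of_real \<nu> - 1) * (z powr ?\<mu>) * z = 1"
    proof -
      have "z powr (of_nat n - of_real \<nu> - 1) * z powr ?\<mu> = z powr (- 1)"
        unfolding powr_add[symmetric] by simp
      thus ?thesis using z0 by (simp add: powr_minus)
    qed
    have a: "bessel_J_deriv n \<nu> z = z powr ?\<mu> * S n z / 2 powr of_real \<nu>"
      unfolding S_def by (rule bessel_J_deriv_series[OF z])
    have "bessel_J_deriv (Suc n) \<nu> z =
        z powr (of_real \<nu> - of_nat (Suc n)) * S (Suc n) z / 2 powr of_real \<nu>"
      unfolding S_def by (rule bessel_J_deriv_series[OF z])
    also have "z powr (of_real \<nu> - of_nat (Suc n)) = z powr (?\<mu> - 1)"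
      by (simp add: algebra_simps)
    finally have b: "z * bessel_J_deriv (Suc n) \<nu> z = z powr ?\<mu> * S (Suc n) z / 2 powr of_real \<nu>"
      unfolding pz by simp
    have "(of_nat n - of_real \<nu>) * bessel_J_deriv n \<nu> z + z * bessel_J_deriv (Suc n) \<nu> z =
        z powr ?\<mu> * (S (Suc n) z - ?\<mu> * S n z) / 2 powr of_real \<nu>"
      unfolding a b by (simp add: field_simps)
    also have "\<dots> = z powr ?\<mu> * z * F z"
      unfolding S F_def by simp
    finally show ?thesis using inv by (simp add: mult.assoc[symmetric])
  qed
  have E: "bessel_LL \<nu> n = F"
    unfolding bessel_LL_def by (rule entire_extension_eqI[OF Fh eq])
  show "bessel_LL \<nu> n holomorphic_on UNIV" unfolding E by (rule Fh)
  show "z \<notin> \<real>\<^sub>\<le>\<^sub>0 \<Longrightarrow> bessel_LL \<nu> n z =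
      z powr (of_nat n - of_real \<nu> - 1) *
          ((of_nat n - of_real \<nu>) * bessel_J_deriv n \<nu> z + z * bessel_J_deriv (Suc n) \<nu> z)"
    unfolding E by (rule eq)
qed

end

theory Submission
  imports Defs "HOL-Computational_Algebra.Fundamental_Theorem_Algebra"
begin

text \<open>
  Write \<open>J\<^sub>\<nu>\<^sup>(\<^sup>n\<^sup>)(x) = 2\<^sup>-\<^sup>\<nu> x\<^sup>\<nu>\<^sup>-\<^sup>n S\<^sub>n(x)\<close> with \<open>S\<^sub>n\<close> even and entire. Everything follows
  from the strict Laguerre inequality \<open>S\<^sub>n'\<^sup>2 - S\<^sub>n S\<^sub>n'' > 0\<close> on the real line: it makes real zeros simple
  and \<open>S\<^sub>n' / S\<^sub>n\<close> strictly decreasing between them, whence interlacing (the factor \<open>x\<^sup>\<nu>\<^sup>-\<^sup>n\<close> does not spoil the inequality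
  when \<open>\<nu> \<ge> n\<close>). For the reality of the zeros, note that a
  real-rooted polynomial \<open>q\<close> satisfies \<open>- Im (q'(z) cnj (q(z))) Im z \<ge> (Im z)\<^sup>2 (q'\<^sup>2 - q q'')(Re z)\<close>, and
  that this inequality survives pointwise limits; since the right-hand side is positive off the
  real axis for \<open>q = S\<^sub>n\<close>, neither \<open>S\<^sub>n\<close> nor \<open>S\<^sub>n'\<close> vanishes there.

  In the variable \<open>w = x\<^sup>2\<close>, \<open>S\<^sub>0\<close> is a limit of rescaled Laguerre polynomials, and \<open>S\<^sub>n\<close> arises from
  it by the operators \<open>(\<nu> - k) + 2 w d/dw\<close>, \<open>k < n\<close>; both constructions preserve polynomials all of
  whose roots are positive. The limit only yields the weak Laguerre inequality. Where
  \<open>S\<^sub>n \<noteq> 0\<close>, strictness holds because equality would bound \<open>S\<^sub>n\<close> on a vertical line; at a zero of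
  \<open>S\<^sub>n\<close> it holds by induction on \<open>n\<close>, starting from Bessel's differential equation. That equation
  also gives infinitely many zeros for \<open>n = 0\<close>, which Rolle's theorem propagates to all \<open>n\<close>.
\<close>

subsection \<open>Real-rooted polynomials\<close>

abbreviation cpoly :: "real poly \<Rightarrow> complex \<Rightarrow> complex" where
  "cpoly p z \<equiv> poly (map_poly of_real p) z"

lemma cpoly_pCons [simp]: "cpoly (pCons c p) z = of_real c + z * cpoly p z"
  by (simp add: map_poly_pCons)

lemma cpoly_of_real [simp]: "cpoly p (of_real x) = of_real (poly p x)"
  by (induction p) auto

lemma cpoly_add [simp]: "cpoly (p + q) z = cpoly p z + cpoly q z"
proof -
  have "map_poly of_real (p + q) = (map_poly of_real p + map_poly of_real q :: complex poly)"
    by (intro poly_eqI) (simp add: coeff_map_poly)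
  thus ?thesis by simp
qed

lemma cpoly_smult [simp]: "cpoly (smult c p) z = of_real c * cpoly p z"
  by (simp add: map_poly_smult)

lemma cpoly_mult [simp]: "cpoly (p * q) z = cpoly p z * cpoly q z"
  by (induction p) (auto simp: algebra_simps)

lemma cpoly_pcompose [simp]: "cpoly (pcompose p q) z = cpoly p (cpoly q z)"
  by (induction p) (auto simp: pcompose_pCons)

lemma Im_of_real_mult: "Im (of_real r * w) = r * Im w"
  by simp

inductive real_rooted :: "real poly \<Rightarrow> bool" where
  const: "real_rooted [:c:]"
| factor: "real_rooted p \<Longrightarrow> real_rooted ([:1, -s:] * p)"

inductive pos_rooted :: "real poly \<Rightarrow> bool" where
  const: "c \<noteq> 0 \<Longrightarrow> pos_rooted [:c:]"
| factor: "pos_rooted p \<Longrightarrow> t > 0 \<Longrightarrow> pos_rooted ([:1, -t:] * p)"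

lemma pos_rooted_imp_real_rooted: "pos_rooted p \<Longrightarrow> real_rooted p"
  by (induction rule: pos_rooted.induct) (auto intro: real_rooted.intros simp del: mult_pCons_left)

text \<open>The fundamental theorem of algebra provides a root r, real and positive by assumption;
  splitting off -r (1 - x / r) lowers the degree.\<close>

lemma pos_rootedI:
  assumes "\<And>z. cpoly p z = 0 \<Longrightarrow> z \<in> \<real> \<and> Re z > 0"
  shows "pos_rooted p"
  using assms
proof (induction "degree p" arbitrary: p)
  case 0
  then obtain c where p: "p = [:c:]" using degree_eq_zeroE by metis
  have "c \<noteq> 0" using "0.prems"[of 0] p by auto
  thus ?case using p pos_rooted.const by simp
next
  case (Suc d)
  have "degree (map_poly of_real p :: complex poly) > 0"
    using Suc.hyps(2) by (subst degree_map_poly) auto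
  from alg_closed_imp_poly_has_root[OF this] obtain z where z: "cpoly p z = 0" by metis
  define r where "r = Re z"
  have r: "z = of_real r" "r > 0" using Suc.prems[OF z] by (auto simp: r_def)
  hence "poly p r = 0" using z by simp
  then obtain q where q: "p = [:-r, 1:] * q" by (auto simp: poly_eq_0_iff_dvd)
  have q0: "q \<noteq> 0" using Suc.hyps(2) q by auto
  have "[:-r, 1:] = smult (-r) [:1, -(1/r):]" using r(2) by simp
  hence p_eq: "p = [:1, -(1/r):] * smult (-r) q"
    by (simp only: q mult_smult_left mult_smult_right)
  have "degree p = Suc (degree q)" unfolding q by (subst degree_mult_eq) (use q0 in auto)
  moreover have "w \<in> \<real> \<and> Re w > 0" if "cpoly (smult (-r) q) w = 0" for w
    using Suc.prems[of w] that[unfolded cpoly_smult] r(2) unfolding q cpoly_mult by simp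
  ultimately have "pos_rooted (smult (-r) q)"
    using Suc.hyps(2) r(2) by (intro Suc.hyps(1)) simp_all
  thus ?case unfolding p_eq by (rule pos_rooted.factor) (simp add: r(2))
qed

text \<open>Off the zeros of p this is -p^2 (p'/p)'. Unrelated to the Laguerre polynomials
  \<open>laguerre_poly\<close> below.\<close>

definition laguerre :: "real poly \<Rightarrow> real \<Rightarrow> real" where
  "laguerre p x = (poly (pderiv p) x)\<^sup>2 - poly p x * poly (pderiv (pderiv p)) x"

lemma pderiv_linear_factor:
  "pderiv ([:1, -s:] * p) = [:1, -s:] * pderiv p - smult s (p :: real poly)"
  unfolding pderiv_mult by (simp add: pderiv_pCons)

lemma poly_linear_factor: "poly ([:1, -s:] * p) x = (1 - s * x) * poly p (x :: real)"
  by (simp add: algebra_simps)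

text \<open>The factor 1 - s x contributes s^2 / (1 - s x)^2 to the additive quantity -(q'/q)'; with
  denominators cleared, the identity also holds at zeros.\<close>

lemma laguerre_factor:
  "laguerre ([:1, -s:] * p) x = s\<^sup>2 * (poly p x)\<^sup>2 + (1 - s * x)\<^sup>2 * laguerre p x"
  unfolding laguerre_def pderiv_linear_factor pderiv_diff pderiv_smult poly_diff poly_smult
    poly_linear_factor
  by (simp add: power2_eq_square algebra_simps)

lemma laguerre_nonneg: "real_rooted p \<Longrightarrow> laguerre p x \<ge> 0"
  by (induction rule: real_rooted.induct)
     (auto simp: laguerre_factor simp del: mult_pCons_left, simp add: laguerre_def pderiv_pCons)

lemma cmod_linear_factor:
  "(cmod (1 - of_real s * z))\<^sup>2 = (1 - s * Re z)\<^sup>2 + s\<^sup>2 * (Im z)\<^sup>2"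
  by (simp add: cmod_power2 power_mult_distrib)

lemma cpoly_linear_factor: "cpoly ([:1, -s:] * p) z = (1 - of_real s * z) * cpoly p z"
  unfolding cpoly_mult by (simp add: mult.commute)

text \<open>Since s is real, 1 - s z has real part 1 - s Re z, so no factor loses modulus when z
  leaves the axis.\<close>

lemma real_rooted_norm_ge:
  assumes "real_rooted p"
  shows "(poly p (Re z))\<^sup>2 \<le> (cmod (cpoly p z))\<^sup>2"
  using assms
proof (induction rule: real_rooted.induct)
  case (factor p s)
  have "(1 - s * Re z)\<^sup>2 * (poly p (Re z))\<^sup>2 \<le> ((1 - s * Re z)\<^sup>2 + s\<^sup>2 * (Im z)\<^sup>2) * (cmod (cpoly p z))\<^sup>2"
    by (intro mult_mono factor.IH) auto
  thus ?case
    unfolding cpoly_linear_factor norm_mult power_mult_distrib cmod_linear_factor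
      poly_linear_factor power_mult_distrib .
qed auto

text \<open>Each factor adds s^2 (Im z)^2 / |1 - s z|^2 to -Im (p'/p) Im z. Multiplying by |p|^2
  avoids the division, and moduli at z dominate those at Re z.\<close>

lemma real_rooted_Im_ge:
  assumes "real_rooted p"
  shows "(Im z)\<^sup>2 * laguerre p (Re z) \<le> - (Im (cpoly (pderiv p) z * cnj (cpoly p z)) * Im z)"
  using assms
proof (induction rule: real_rooted.induct)
  case (const c)
  thus ?case by (simp add: laguerre_def pderiv_pCons)
next
  case (factor p s)
  let ?A = "1 - of_real s * z" and ?P = "cpoly p z" and ?P' = "cpoly (pderiv p) z"
  have d: "cpoly (pderiv ([:1, -s:] * p)) z = ?A * ?P' - of_real s * ?P"
    unfolding pderiv_linear_factor diff_conv_add_uminus smult_minus_left[symmetric]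
      cpoly_add cpoly_linear_factor cpoly_smult by simp
  \<comment> \<open>Multiplying by the conjugate of the full product separates |A|^2 times the old
    quantity from the contribution of the new factor.\<close>
  have "(?A * ?P' - of_real s * ?P) * cnj (?A * ?P) =
      of_real ((cmod ?A)\<^sup>2) * (?P' * cnj ?P) - of_real (s * (cmod ?P)\<^sup>2) * cnj ?A"
    unfolding of_real_mult complex_norm_square by (simp add: algebra_simps)
  hence "Im (cpoly (pderiv ([:1, -s:] * p)) z * cnj (cpoly ([:1, -s:] * p) z)) =
      (cmod ?A)\<^sup>2 * Im (?P' * cnj ?P) - s * (cmod ?P)\<^sup>2 * Im (cnj ?A)"
    unfolding d cpoly_linear_factor by (simp only: minus_complex.simps Im_of_real_mult)
  also have "Im (cnj ?A) = s * Im z" by simp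
  finally have eq: "Im (cpoly (pderiv ([:1, -s:] * p)) z * cnj (cpoly ([:1, -s:] * p) z)) =
      (cmod ?A)\<^sup>2 * Im (?P' * cnj ?P) - s * (cmod ?P)\<^sup>2 * (s * Im z)" .
  have "- ((a * b - s * c * (s * y)) * y) = a * - (b * y) + s\<^sup>2 * y\<^sup>2 * c" for a b c y :: real
    by (simp add: power2_eq_square algebra_simps)
  hence "- (Im (cpoly (pderiv ([:1, -s:] * p)) z * cnj (cpoly ([:1, -s:] * p) z)) * Im z) =
      (cmod ?A)\<^sup>2 * - (Im (?P' * cnj ?P) * Im z) + s\<^sup>2 * (Im z)\<^sup>2 * (cmod ?P)\<^sup>2"
    unfolding eq .
  also have "\<dots> \<ge> (1 - s * Re z)\<^sup>2 * ((Im z)\<^sup>2 * laguerre p (Re z)) + s\<^sup>2 * (Im z)\<^sup>2 * (poly p (Re z))\<^sup>2"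
  proof (intro add_mono mult_mono factor.IH mult_left_mono real_rooted_norm_ge factor.hyps)
    show "(1 - s * Re z)\<^sup>2 \<le> (cmod ?A)\<^sup>2" unfolding cmod_linear_factor by simp
  qed (auto intro!: mult_nonneg_nonneg laguerre_nonneg factor.hyps)
  finally show ?case unfolding laguerre_factor by (simp add: algebra_simps)
qed

text \<open>With a = 1 - s Re z, |1 - s z|^2 = a^2 (1 + (s Im z / a)^2), and 1 + t \<le> exp t turns
  the product into the exponential of a sum, which additivity identifies.\<close>

lemma real_rooted_norm_le:
  assumes "real_rooted p" "poly p (Re z) \<noteq> 0"
  shows "(cmod (cpoly p z))\<^sup>2 \<le>
    (poly p (Re z))\<^sup>2 * exp ((Im z)\<^sup>2 * laguerre p (Re z) / (poly p (Re z))\<^sup>2)"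
  using assms
proof (induction rule: real_rooted.induct)
  case (factor p s)
  define a b L y where "a = 1 - s * Re z" and "b = poly p (Re z)"
    and "L = laguerre p (Re z)" and "y = Im z"
  have nz: "a \<noteq> 0" "b \<noteq> 0" using factor.prems by (auto simp: a_def b_def algebra_simps)
  have "(cmod (1 - of_real s * z))\<^sup>2 = a\<^sup>2 * (1 + y\<^sup>2 * s\<^sup>2 / a\<^sup>2)"
    unfolding cmod_linear_factor a_def[symmetric] y_def[symmetric] using nz by (simp add: field_simps)
  also have "\<dots> \<le> a\<^sup>2 * exp (y\<^sup>2 * s\<^sup>2 / a\<^sup>2)"
    by (intro mult_left_mono exp_ge_add_one_self) auto
  finally have "(cmod (1 - of_real s * z))\<^sup>2 * (cmod (cpoly p z))\<^sup>2 \<le>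
      (a\<^sup>2 * exp (y\<^sup>2 * s\<^sup>2 / a\<^sup>2)) * (b\<^sup>2 * exp (y\<^sup>2 * L / b\<^sup>2))"
    using factor.IH nz unfolding b_def L_def y_def by (intro mult_mono) auto
  also have "\<dots> = (a * b)\<^sup>2 * exp (y\<^sup>2 * s\<^sup>2 / a\<^sup>2 + y\<^sup>2 * L / b\<^sup>2)"
    by (simp add: exp_add power_mult_distrib)
  also have "y\<^sup>2 * s\<^sup>2 / a\<^sup>2 + y\<^sup>2 * L / b\<^sup>2 = y\<^sup>2 * (s\<^sup>2 * b\<^sup>2 + a\<^sup>2 * L) / (a * b)\<^sup>2"
    using nz by (simp add: field_simps)
  also have "s\<^sup>2 * b\<^sup>2 + a\<^sup>2 * L = laguerre ([:1, -s:] * p) (Re z)"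
    unfolding laguerre_factor by (simp add: a_def b_def L_def)
  also have "a * b = poly ([:1, -s:] * p) (Re z)" by (simp add: a_def b_def algebra_simps)
  finally show ?case
    unfolding cpoly_linear_factor norm_mult power_mult_distrib y_def .
qed (simp add: laguerre_def pderiv_pCons power2_eq_square)

text \<open>Here 1 - t Re w is nonnegative and is the real part of 1 - t w. Squares of points high
  on a vertical line lie in this half-plane.\<close>

lemma pos_rooted_norm_ge:
  assumes "pos_rooted p" "Re w \<le> 0"
  shows "\<bar>poly p (Re w)\<bar> \<le> cmod (cpoly p w)"
  using assms
proof (induction rule: pos_rooted.induct)
  case (factor p t)
  have "t * Re w \<le> 0" using factor by (simp add: mult_nonneg_nonpos)
  hence "0 \<le> 1 - t * Re w" by simp
  moreover have "1 - t * Re w \<le> cmod (1 - of_real t * w)"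
    using complex_Re_le_cmod[of "1 - of_real t * w"] by simp
  ultimately have "\<bar>1 - t * Re w\<bar> * \<bar>poly p (Re w)\<bar> \<le> cmod (1 - of_real t * w) * cmod (cpoly p w)"
    by (intro mult_mono factor) auto
  thus ?case unfolding cpoly_linear_factor norm_mult poly_linear_factor abs_mult .
qed auto

text \<open>A factor 1 - t x^2 splits into 1 - sqrt t x and 1 + sqrt t x.\<close>

lemma pos_rooted_sq:
  assumes "pos_rooted p"
  shows "real_rooted (pcompose p [:0, 0, 1:])"
  using assms
proof (induction rule: pos_rooted.induct)
  case (factor p t)
  have "pcompose ([:1, -t:] * p) [:0, 0, 1:] =
      [:1, -sqrt t:] * ([:1, -(-sqrt t):] * pcompose p [:0, 0, 1:])"
  proof -
    have "pcompose [:1, -t:] [:0, 0, 1:] = [:1, 0, -t:]" by (simp add: pcompose_pCons)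
    also have "\<dots> = [:1, -sqrt t:] * [:1, -(-sqrt t):]" using factor.hyps by simp
    finally show ?thesis unfolding pcompose_mult by (simp only: mult.assoc)
  qed
  thus ?case by (simp only: real_rooted.factor[OF real_rooted.factor[OF factor.IH]])
qed (auto intro: real_rooted.intros)

text \<open>For x \<le> 0 each factor 1 - t x is positive with logarithmic derivative -t / (1 - t x)
  < 0. This excludes nonpositive roots in \<open>pos_rooted_operator\<close>.\<close>

lemma pos_rooted_nonpos:
  assumes "pos_rooted p" "x \<le> 0"
  shows "poly p x \<noteq> 0 \<and> poly p x * poly (pderiv p) x \<le> 0"
  using assms
proof (induction rule: pos_rooted.induct)
  case (factor p t)
  have a: "1 - t * x > 0" using factor by (smt (verit) mult_nonneg_nonpos)
  note eq = poly_linear_factor[of t p x]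
  have "poly ([:1, -t:] * p) x * poly (pderiv ([:1, -t:] * p)) x =
      (1 - t * x)\<^sup>2 * (poly p x * poly (pderiv p) x) - t * (1 - t * x) * (poly p x)\<^sup>2"
    unfolding pderiv_linear_factor poly_diff poly_linear_factor poly_smult
    by (simp add: power2_eq_square algebra_simps)
  also have "\<dots> \<le> 0"
    using factor a by (smt (verit) mult_nonneg_nonpos zero_le_power2 mult_nonneg_nonneg)
  finally show ?case using eq a factor by (simp only: mult_eq_0_iff) (auto simp: mult.commute)
qed (auto simp: pderiv_pCons)

lemma pos_rooted_nonreal:
  assumes "pos_rooted p" "Im z \<noteq> 0"
  shows "cpoly p z \<noteq> 0"
  using assms
proof (induction rule: pos_rooted.induct)
  case (factor p t)
  have "Im (1 - of_real t * z) \<noteq> 0" using factor by simp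
  hence "1 - of_real t * z \<noteq> 0" by (metis zero_complex.simps(2))
  thus ?case unfolding cpoly_linear_factor using factor by simp
qed auto

text \<open>Serves both constructions: the recurrence of the Laguerre polynomials (a = 1) and the
  operators (\<nu> - k) + 2 w d/dw (b = 0, c = 2).\<close>

lemma pos_rooted_operator:
  assumes p: "pos_rooted p" and a: "a > 0" and b: "b \<ge> 0" and c: "c \<ge> 0"
  shows "pos_rooted ([:a, -b:] * p + smult c ([:0, 1:] * pderiv p))"
proof (rule pos_rootedI)
  fix z assume "cpoly ([:a, -b:] * p + smult c ([:0, 1:] * pderiv p)) z = 0"
  hence z: "(of_real a - of_real b * z) * cpoly p z + of_real c * z * cpoly (pderiv p) z = 0"
    unfolding cpoly_add cpoly_smult cpoly_mult by (simp add: algebra_simps)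
  \<comment> \<open>Dividing by \<open>z\<close> makes the \<open>b\<close>-term real and leaves two terms whose imaginary parts have the same sign.\<close>
  have Im0: "Im z = 0"
  proof (rule ccontr)
    assume y: "Im z \<noteq> 0"
    hence z0: "z \<noteq> 0" by auto
    let ?P = "cpoly p z" and ?P' = "cpoly (pderiv p) z"
    have "?P \<noteq> 0" using pos_rooted_nonreal[OF p y] .
    hence P: "cmod ?P > 0" by simp
    have "0 = ((of_real a - of_real b * z) * ?P + of_real c * z * ?P') * cnj ?P / z"
      unfolding z by simp
    also have "\<dots> = of_real (a * (cmod ?P)\<^sup>2) / z - of_real (b * (cmod ?P)\<^sup>2) + of_real c * (?P' * cnj ?P)"
      unfolding of_real_mult complex_norm_square using z0 by (simp add: field_simps)
    finally have "0 = Im (of_real (a * (cmod ?P)\<^sup>2) / z - of_real (b * (cmod ?P)\<^sup>2) + of_real c * (?P' * cnj ?P))"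
      by (metis zero_complex.simps(2))
    also have "\<dots> = a * (cmod ?P)\<^sup>2 * Im (1 / z) + c * Im (?P' * cnj ?P)"
      unfolding plus_complex.simps minus_complex.simps divide_inverse Im_of_real_mult by simp
    also have "Im (1 / z) = - Im z / (cmod z)\<^sup>2"
      by (simp add: Im_divide cmod_power2)
    finally have "0 = (a * (cmod ?P)\<^sup>2 * (- Im z / (cmod z)\<^sup>2) + c * Im (?P' * cnj ?P)) * Im z"
      by simp
    also have "\<dots> = - (a * (cmod ?P)\<^sup>2 * (Im z)\<^sup>2 / (cmod z)\<^sup>2) + c * (Im (?P' * cnj ?P) * Im z)"
      by (simp add: algebra_simps power2_eq_square)
    finally have "a * (cmod ?P)\<^sup>2 * (Im z)\<^sup>2 / (cmod z)\<^sup>2 = c * (Im (?P' * cnj ?P) * Im z)" by simp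
    moreover have "a * (cmod ?P)\<^sup>2 * (Im z)\<^sup>2 / (cmod z)\<^sup>2 > 0" using a P y z0 by simp
    moreover have "Im (?P' * cnj ?P) * Im z \<le> 0"
      using real_rooted_Im_ge[OF pos_rooted_imp_real_rooted[OF p], of z]
        laguerre_nonneg[OF pos_rooted_imp_real_rooted[OF p], of "Re z"]
      by (smt (verit) mult_nonneg_nonneg zero_le_power2)
    ultimately show False using c by (smt (verit) mult_nonneg_nonpos)
  qed
  define x where "x = Re z"
  have zx: "z = of_real x" using Im0 by (simp add: x_def complex_eq_iff)
  have eq: "(a - b * x) * poly p x + c * x * poly (pderiv p) x = 0"
    using z unfolding zx cpoly_of_real by (metis of_real_add of_real_diff of_real_eq_0_iff of_real_mult)
  have "x > 0"
  proof (rule ccontr)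
    assume "\<not> x > 0"
    hence x: "x \<le> 0" by simp
    note P = pos_rooted_nonpos[OF p x]
    \<comment> \<open>After multiplication by p(x) the first summand is positive and the second
      nonnegative.\<close>
    have "0 = (a - b * x) * (poly p x)\<^sup>2 + (c * x) * (poly p x * poly (pderiv p) x)"
      using arg_cong[OF eq, of "\<lambda>t. t * poly p x"] by (simp add: algebra_simps power2_eq_square)
    moreover have "a - b * x > 0" using a b x by (smt (verit) mult_nonneg_nonpos)
    hence "(a - b * x) * (poly p x)\<^sup>2 > 0" using P by simp
    moreover have "(c * x) * (poly p x * poly (pderiv p) x) \<ge> 0"
      using P x c by (intro mult_nonpos_nonpos) (auto simp: mult_nonneg_nonpos)
    ultimately show False by linarith
  qed
  thus "z \<in> \<real> \<and> Re z > 0" by (simp add: zx)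
qed

subsection \<open>Limits of polynomials with positive roots\<close>

text \<open>The polymorphic argument lets the real and the complex function share their real
  coefficients.\<close>

definition ser :: "(nat \<Rightarrow> real) \<Rightarrow> 'a::{real_normed_field,banach} \<Rightarrow> 'a" where
  "ser a z = (\<Sum>m. of_real (a m) * z ^ m)"

definition entire_coeffs :: "(nat \<Rightarrow> real) \<Rightarrow> bool" where
  "entire_coeffs a \<longleftrightarrow> (\<forall>r. summable (\<lambda>m. \<bar>a m\<bar> * r ^ m))"

lemma summable_ser:
  fixes z :: "'a::{real_normed_field,banach}"
  assumes "entire_coeffs a"
  shows "summable (\<lambda>m. of_real (a m) * z ^ m)"
proof (rule summable_norm_cancel)
  show "summable (\<lambda>m. norm (of_real (a m) * z ^ m))"
    using assms by (simp add: entire_coeffs_def norm_mult norm_power)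
qed

lemma entire_coeffs_diffs: "entire_coeffs a \<Longrightarrow> entire_coeffs (diffs a)"
proof -
  assume "entire_coeffs a"
  hence "summable (\<lambda>m. diffs (\<lambda>m. \<bar>a m\<bar>) m * r ^ m)" for r :: real
    by (intro termdiff_converges_all) (simp add: entire_coeffs_def)
  moreover have "diffs (\<lambda>m. \<bar>a m\<bar>) m = \<bar>diffs a m\<bar>" for m
    by (simp add: diffs_def abs_mult)
  ultimately show ?thesis by (simp add: entire_coeffs_def)
qed

lemma ser_of_real:
  assumes "entire_coeffs a"
  shows "ser a (of_real x) = (of_real (ser a x) :: 'a::{real_normed_field,banach})"
proof -
  have "summable (\<lambda>m. a m * x ^ m)" using summable_ser[OF assms, of x] by simp
  hence "(\<lambda>m. of_real (a m * x ^ m)) sums (of_real (\<Sum>m. a m * x ^ m) :: 'a)"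
    by (intro sums_of_real summable_sums)
  thus ?thesis unfolding ser_def by (intro sums_unique[symmetric]) simp
qed

lemma ser_0: "ser a 0 = of_real (a 0)"
  unfolding ser_def using powser_zero[of "\<lambda>m. of_real (a m)"] by simp

lemma DERIV_ser:
  fixes z :: "'a::{real_normed_field,banach}"
  assumes "entire_coeffs a"
  shows "(ser a has_field_derivative ser (diffs a) z) (at z)"
proof -
  have "diffs (\<lambda>m. of_real (a m)) m = (of_real (diffs a m) :: 'a)" for m
    by (simp add: diffs_def)
  with termdiffs_strong_converges_everywhere[of "\<lambda>m. of_real (a m)" z, OF summable_ser[OF assms]]
  show ?thesis unfolding ser_def by simp
qed

lemma cpoly_conv_ser: "cpoly p z = ser (coeff p) z"
proof -
  have "ser (coeff p) z = (\<Sum>m\<le>degree p. of_real (coeff p m) * z ^ m)"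
    unfolding ser_def by (intro suminf_finite) (auto simp: coeff_eq_0)
  thus ?thesis
    by (simp add: poly_altdef degree_map_poly coeff_map_poly)
qed

lemma cpoly_tendsto_ser:
  assumes a: "entire_coeffs a"
    and \<theta>: "\<And>N m. \<bar>\<theta> N m\<bar> \<le> 1" "\<And>m. (\<lambda>N. \<theta> N m) \<longlonglongrightarrow> 1"
    and p: "\<And>N m. coeff (p N) m = a m * \<theta> N m"
  shows "(\<lambda>N. cpoly (p N) z) \<longlonglongrightarrow> ser a z"
proof -
  have "(\<lambda>N. \<Sum>m. of_real (a m * \<theta> N m) * z ^ m) \<longlonglongrightarrow> (\<Sum>m. of_real (a m) * z ^ m)"
  proof (rule tannerys_theorem[where M = "\<lambda>m. \<bar>a m\<bar> * norm z ^ m", THEN conjunct2, THEN conjunct2])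
    fix m
    have "(\<lambda>N. of_real (a m * \<theta> N m) * z ^ m) \<longlonglongrightarrow> of_real (a m * 1) * z ^ m"
      by (intro tendsto_intros \<theta>)
    thus "(\<lambda>N. of_real (a m * \<theta> N m) * z ^ m) \<longlonglongrightarrow> of_real (a m) * z ^ m" by simp
  next
    have "norm (complex_of_real (a m * \<theta> N m) * z ^ m) \<le> \<bar>a m\<bar> * norm z ^ m" for m N
      using mult_left_mono[OF \<theta>(1)[of N m], of "\<bar>a m\<bar> * norm z ^ m"]
      by (simp add: norm_mult norm_power abs_mult mult_ac)
    thus "\<forall>\<^sub>F (m, N) in sequentially \<times>\<^sub>F sequentially.
        norm (complex_of_real (a m * \<theta> N m) * z ^ m) \<le> \<bar>a m\<bar> * norm z ^ m"
      by (intro always_eventually) auto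
  qed (use a in \<open>auto simp: entire_coeffs_def\<close>)
  thus ?thesis unfolding cpoly_conv_ser p[abs_def] ser_def p .
qed

text \<open>
  The multipliers \<open>\<theta>\<close> provide a majorant, so that Tannery's theorem gives the pointwise
  convergence of all derivatives.
\<close>

definition pos_limit :: "(nat \<Rightarrow> real) \<Rightarrow> bool" where
  "pos_limit a \<longleftrightarrow> entire_coeffs a \<and>
     (\<exists>p \<theta>. (\<forall>N. pos_rooted (p N)) \<and> (\<forall>N m. \<bar>\<theta> N m\<bar> \<le> 1) \<and> (\<forall>m. (\<lambda>N. \<theta> N m) \<longlonglongrightarrow> (1::real)) \<and>
        (\<forall>N m. coeff (p N) m = a m * \<theta> N m))"

text \<open>Differentiation shifts the multipliers along with the coefficients, from
  \<open>\<theta> N m\<close> to \<open>\<theta> N (Suc m)\<close>, so their bound and their limit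
  persist.\<close>

lemma pos_limitE:
  assumes "pos_limit a"
  obtains p where "\<And>N. pos_rooted (p N)" "\<And>z. (\<lambda>N. cpoly (p N) z) \<longlonglongrightarrow> ser a z"
    "\<And>z. (\<lambda>N. cpoly (pderiv (p N)) z) \<longlonglongrightarrow> ser (diffs a) z"
    "\<And>z. (\<lambda>N. cpoly (pderiv (pderiv (p N))) z) \<longlonglongrightarrow> ser (diffs (diffs a)) z"
proof -
  from assms obtain p \<theta> where p: "\<And>N. pos_rooted (p N)" and
    \<theta>: "\<And>N m. \<bar>\<theta> N m\<bar> \<le> 1" "\<And>m. (\<lambda>N. \<theta> N m) \<longlonglongrightarrow> 1" and
    co: "\<And>N m. coeff (p N) m = a m * \<theta> N m" and a: "entire_coeffs a"
    unfolding pos_limit_def by metis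
  note a1 = entire_coeffs_diffs[OF a]
  note a2 = entire_coeffs_diffs[OF a1]
  show thesis
  proof (rule that[OF p])
    show "(\<lambda>N. cpoly (p N) z) \<longlonglongrightarrow> ser a z" for z
      by (rule cpoly_tendsto_ser[OF a \<theta> co])
    show "(\<lambda>N. cpoly (pderiv (p N)) z) \<longlonglongrightarrow> ser (diffs a) z" for z
      by (rule cpoly_tendsto_ser[where \<theta> = "\<lambda>N m. \<theta> N (Suc m)", OF a1 \<theta>(1) \<theta>(2)])
         (simp add: coeff_pderiv co diffs_def)
    show "(\<lambda>N. cpoly (pderiv (pderiv (p N))) z) \<longlonglongrightarrow> ser (diffs (diffs a)) z" for z
      by (rule cpoly_tendsto_ser[where \<theta> = "\<lambda>N m. \<theta> N (Suc (Suc m))", OF a2 \<theta>(1) \<theta>(2)])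
         (simp add: coeff_pderiv co diffs_def)
  qed
qed

section \<open>The even functions obtained by substituting w = z^2, and their Laguerre
  inequality\<close>

definition even0 :: "(nat \<Rightarrow> real) \<Rightarrow> 'a::{real_normed_field,banach} \<Rightarrow> 'a" where
  "even0 a z = ser a (z\<^sup>2)"
text \<open>\<open>even1\<close> and \<open>even2\<close> are the first two derivatives of
  \<open>even0\<close>, written as explicit series so that limits of polynomial derivatives can be
  matched with them.\<close>

definition even1 :: "(nat \<Rightarrow> real) \<Rightarrow> 'a::{real_normed_field,banach} \<Rightarrow> 'a" where
  "even1 a z = 2 * z * ser (diffs a) (z\<^sup>2)"
definition even2 :: "(nat \<Rightarrow> real) \<Rightarrow> 'a::{real_normed_field,banach} \<Rightarrow> 'a" where
  "even2 a z = 2 * ser (diffs a) (z\<^sup>2) + 4 * z\<^sup>2 * ser (diffs (diffs a)) (z\<^sup>2)"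

lemma DERIV_even0:
  assumes "entire_coeffs a"
  shows "(even0 a has_field_derivative even1 a z) (at z)"
proof -
  have "((\<lambda>z. ser a (z\<^sup>2)) has_field_derivative ser (diffs a) (z\<^sup>2) * (2 * z)) (at z)"
    by (rule DERIV_chain2[OF DERIV_ser[OF assms]]) (auto intro!: derivative_eq_intros)
  thus ?thesis unfolding even0_def even1_def by (simp add: mult_ac)
qed

lemma DERIV_even1:
  assumes "entire_coeffs a"
  shows "(even1 a has_field_derivative even2 a z) (at z)"
proof -
  have "((\<lambda>z. ser (diffs a) (z\<^sup>2)) has_field_derivative ser (diffs (diffs a)) (z\<^sup>2) * (2 * z)) (at z)"
    by (rule DERIV_chain2[OF DERIV_ser[OF entire_coeffs_diffs[OF assms]]])
       (auto intro!: derivative_eq_intros)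
  note D = DERIV_mult[OF DERIV_cmult_Id[of 2] this]
  show ?thesis
    unfolding even1_def even2_def by (rule DERIV_cong[OF D]) (simp add: power2_eq_square algebra_simps)
qed

lemma even_of_real:
  assumes "entire_coeffs a"
  shows "even0 a (of_real x) = (of_real (even0 a x) :: complex)"
    and "even1 a (of_real x) = (of_real (even1 a x) :: complex)"
    and "even2 a (of_real x) = (of_real (even2 a x) :: complex)"
  using assms entire_coeffs_diffs[OF assms] entire_coeffs_diffs[OF entire_coeffs_diffs[OF assms]]
  by (auto simp: even0_def even1_def even2_def ser_of_real simp flip: of_real_power)

definition even_laguerre :: "(nat \<Rightarrow> real) \<Rightarrow> real \<Rightarrow> real" where
  "even_laguerre a x = (even1 a x)\<^sup>2 - even0 a x * even2 a x"

text \<open>Substituting z^2 into the approximants turns positive roots into pairs of real ones, and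
  convergence of two derivatives carries over to the Laguerre expression.\<close>

lemma pos_limit_evenE:
  assumes "pos_limit a"
  obtains q where "\<And>N. real_rooted (q N)" "\<And>z. (\<lambda>N. cpoly (q N) z) \<longlonglongrightarrow> even0 a z"
    "\<And>z. (\<lambda>N. cpoly (pderiv (q N)) z) \<longlonglongrightarrow> even1 a z"
    "\<And>x. (\<lambda>N. poly (q N) x) \<longlonglongrightarrow> even0 a x"
    "\<And>x. (\<lambda>N. laguerre (q N) x) \<longlonglongrightarrow> even_laguerre a x"
proof -
  have a: "entire_coeffs a" using assms by (simp add: pos_limit_def)
  obtain p where p: "\<And>N. pos_rooted (p N)" and
    lim: "\<And>z. (\<lambda>N. cpoly (p N) z) \<longlonglongrightarrow> ser a z"
    "\<And>z. (\<lambda>N. cpoly (pderiv (p N)) z) \<longlonglongrightarrow> ser (diffs a) z"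
    "\<And>z. (\<lambda>N. cpoly (pderiv (pderiv (p N))) z) \<longlonglongrightarrow> ser (diffs (diffs a)) z"
    using pos_limitE[OF assms] by metis
  define q where "q N = pcompose (p N) [:0, 0, 1:]" for N
  have e0: "cpoly (q N) z = cpoly (p N) (z\<^sup>2)" for N z
    by (simp add: q_def power2_eq_square)
  have dq: "pderiv (q N) = pcompose (pderiv (p N)) [:0, 0, 1:] * [:0, 2:]" for N
    unfolding q_def pderiv_pcompose by (simp add: pderiv_pCons)
  have e1: "cpoly (pderiv (q N)) z = 2 * z * cpoly (pderiv (p N)) (z\<^sup>2)" for N z
    unfolding dq cpoly_mult by (simp add: power2_eq_square mult.commute)
  have e2: "cpoly (pderiv (pderiv (q N))) z =
      2 * cpoly (pderiv (p N)) (z\<^sup>2) + 4 * z\<^sup>2 * cpoly (pderiv (pderiv (p N))) (z\<^sup>2)" for N z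
    unfolding dq pderiv_mult pderiv_pcompose cpoly_add cpoly_mult cpoly_pcompose
    by (simp add: pderiv_pCons power2_eq_square algebra_simps)
  have l0: "(\<lambda>N. cpoly (q N) z) \<longlonglongrightarrow> even0 a z" for z
    unfolding e0 even0_def by (rule lim)
  have l1: "(\<lambda>N. cpoly (pderiv (q N)) z) \<longlonglongrightarrow> even1 a z" for z
    unfolding e1 even1_def by (intro tendsto_intros lim)
  have l2: "(\<lambda>N. cpoly (pderiv (pderiv (q N))) z) \<longlonglongrightarrow> even2 a z" for z
    unfolding e2 even2_def by (intro tendsto_intros lim)
  have r0: "(\<lambda>N. poly (q N) x) \<longlonglongrightarrow> even0 a x" for x
    using l0[of "of_real x"] unfolding even_of_real[OF a] cpoly_of_real tendsto_of_real_iff .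
  have r1: "(\<lambda>N. poly (pderiv (q N)) x) \<longlonglongrightarrow> even1 a x" for x
    using l1[of "of_real x"] unfolding even_of_real[OF a] cpoly_of_real tendsto_of_real_iff .
  have r2: "(\<lambda>N. poly (pderiv (pderiv (q N))) x) \<longlonglongrightarrow> even2 a x" for x
    using l2[of "of_real x"] unfolding even_of_real[OF a] cpoly_of_real tendsto_of_real_iff .
  show thesis
  proof (rule that[OF _ l0 l1 r0])
    show "real_rooted (q N)" for N unfolding q_def by (rule pos_rooted_sq[OF p])
    show "(\<lambda>N. laguerre (q N) x) \<longlonglongrightarrow> even_laguerre a x" for x
      unfolding laguerre_def even_laguerre_def by (intro tendsto_intros r0 r1 r2)
  qed
qed

lemma even_laguerre_nonneg:
  assumes "pos_limit a"
  shows "even_laguerre a x \<ge> 0"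
proof -
  obtain q where "\<And>N. real_rooted (q N)" "(\<lambda>N. laguerre (q N) x) \<longlonglongrightarrow> even_laguerre a x"
    using pos_limit_evenE[OF assms] by metis
  thus ?thesis by (intro LIMSEQ_le_const) (auto intro: laguerre_nonneg)
qed

lemma even_laguerre_le_Im:
  assumes "pos_limit a"
  shows "(Im z)\<^sup>2 * even_laguerre a (Re z) \<le> - (Im (even1 a z * cnj (even0 a z)) * Im z)"
proof -
  obtain q where q: "\<And>N. real_rooted (q N)" "(\<lambda>N. laguerre (q N) (Re z)) \<longlonglongrightarrow> even_laguerre a (Re z)"
    "(\<lambda>N. cpoly (q N) z) \<longlonglongrightarrow> even0 a z" "(\<lambda>N. cpoly (pderiv (q N)) z) \<longlonglongrightarrow> even1 a z"
    using pos_limit_evenE[OF assms] by metis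
  show ?thesis
  proof (rule LIMSEQ_le)
    show "(\<lambda>N. (Im z)\<^sup>2 * laguerre (q N) (Re z)) \<longlonglongrightarrow> (Im z)\<^sup>2 * even_laguerre a (Re z)"
      by (intro tendsto_intros q)
    show "(\<lambda>N. - (Im (cpoly (pderiv (q N)) z * cnj (cpoly (q N) z)) * Im z)) \<longlonglongrightarrow>
        - (Im (even1 a z * cnj (even0 a z)) * Im z)"
      by (intro tendsto_intros q)
  qed (use real_rooted_Im_ge[OF q(1)] in blast)
qed

lemma even0_norm_le:
  assumes "pos_limit a" and nz: "even0 a (Re z) \<noteq> 0"
  shows "(cmod (even0 a z))\<^sup>2 \<le>
    (even0 a (Re z))\<^sup>2 * exp ((Im z)\<^sup>2 * even_laguerre a (Re z) / (even0 a (Re z))\<^sup>2)"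
proof -
  obtain q where q: "\<And>N. real_rooted (q N)" "(\<lambda>N. laguerre (q N) (Re z)) \<longlonglongrightarrow> even_laguerre a (Re z)"
    "(\<lambda>N. cpoly (q N) z) \<longlonglongrightarrow> even0 a z" "(\<lambda>N. poly (q N) (Re z)) \<longlonglongrightarrow> even0 a (Re z)"
    using pos_limit_evenE[OF assms(1)] by metis
  \<comment> \<open>\<open>real_rooted_norm_le\<close> needs a nonzero value on the axis; the
    approximants inherit it eventually from the limit.\<close>
  have "\<forall>\<^sub>F N in sequentially. poly (q N) (Re z) \<noteq> 0"
    using tendsto_imp_eventually_ne[OF q(4) nz] .
  hence ev: "\<forall>\<^sub>F N in sequentially. (cmod (cpoly (q N) z))\<^sup>2 \<le>
    (poly (q N) (Re z))\<^sup>2 * exp ((Im z)\<^sup>2 * laguerre (q N) (Re z) / (poly (q N) (Re z))\<^sup>2)"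
    by eventually_elim (rule real_rooted_norm_le[OF q(1)])
  show ?thesis
  proof (rule tendsto_le[OF _ _ _ ev])
    show "(\<lambda>N. (poly (q N) (Re z))\<^sup>2 * exp ((Im z)\<^sup>2 * laguerre (q N) (Re z) / (poly (q N) (Re z))\<^sup>2))
      \<longlonglongrightarrow> (even0 a (Re z))\<^sup>2 * exp ((Im z)\<^sup>2 * even_laguerre a (Re z) / (even0 a (Re z))\<^sup>2)"
      by (intro tendsto_intros q) (use nz in auto)
    show "(\<lambda>N. (cmod (cpoly (q N) z))\<^sup>2) \<longlonglongrightarrow> (cmod (even0 a z))\<^sup>2"
      by (intro tendsto_intros q)
  qed auto
qed

lemma ser_norm_ge:
  assumes "pos_limit a" "Re w \<le> 0"
  shows "\<bar>ser a (Re w)\<bar> \<le> cmod (ser a w)"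
proof -
  have a: "entire_coeffs a" using assms by (simp add: pos_limit_def)
  obtain p where p: "\<And>N. pos_rooted (p N)" and
    lim: "\<And>z. (\<lambda>N. cpoly (p N) z) \<longlonglongrightarrow> ser a z"
    using pos_limitE[OF assms(1)] by metis
  have "(\<lambda>N. poly (p N) (Re w)) \<longlonglongrightarrow> ser a (Re w)"
    using lim[of "of_real (Re w)"] unfolding ser_of_real[OF a] cpoly_of_real tendsto_of_real_iff .
  hence "(\<lambda>N. \<bar>poly (p N) (Re w)\<bar>) \<longlonglongrightarrow> \<bar>ser a (Re w)\<bar>" by (rule tendsto_rabs)
  moreover have "(\<lambda>N. cmod (cpoly (p N) w)) \<longlonglongrightarrow> cmod (ser a w)"
    by (intro tendsto_intros lim)
  ultimately show ?thesis
    by (rule LIMSEQ_le) (use pos_rooted_norm_ge[OF p assms(2)] in blast)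
qed

text \<open>If the expression vanished at x, \<open>even0_norm_le\<close> would bound
  \<open>even0 a\<close> by its value at x on the whole line Re z = x. Alternating signs of the
  coefficients contradict this high up on the line.\<close>

lemma even_laguerre_pos_nonzero:
  assumes "pos_limit a" and sgn: "\<And>m. (-1) ^ m * a m > 0" and nz: "even0 a x \<noteq> 0"
  shows "even_laguerre a x > 0"
proof (rule ccontr)
  assume "\<not> even_laguerre a x > 0"
  hence L: "even_laguerre a x = 0" using even_laguerre_nonneg[OF assms(1), of x] by simp
  have a: "entire_coeffs a" using assms by (simp add: pos_limit_def)
  have a1: "a 1 < 0" using sgn[of 1] by simp
  \<comment> \<open>At -t all terms of the series are nonnegative, so the linear term alone is a
    lower bound.\<close>
  have growth: "ser a (- t) \<ge> - a 1 * t" if t: "t \<ge> 0" for t :: real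
  proof -
    have term_nonneg: "a m * (- t) ^ m \<ge> 0" for m
    proof -
      have "a m * (- t) ^ m = ((-1) ^ m * a m) * t ^ m"
        by (subst power_minus) (simp add: mult_ac)
      also have "\<dots> \<ge> 0" by (intro mult_nonneg_nonneg less_imp_le[OF sgn] zero_le_power t)
      finally show ?thesis .
    qed
    have "(\<Sum>m\<in>{1}. a m * (- t) ^ m) \<le> (\<Sum>m. a m * (- t) ^ m)"
      using summable_ser[OF a, of "- t"] term_nonneg by (intro sum_le_suminf) auto
    thus ?thesis by (simp add: ser_def)
  qed
  \<comment> \<open>T makes the linear lower bound exceed the value at x by 1; y below is then
    chosen so that Re (z^2) = x^2 - y^2 = -T.\<close>
  define T where "T = (\<bar>even0 a x\<bar> + 1) / - a 1"
  have T: "T > 0" using a1 unfolding T_def by (intro divide_pos_pos) auto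
  define y where "y = sqrt (x\<^sup>2 + T)"
  have y: "y\<^sup>2 = x\<^sup>2 + T" using T by (simp add: y_def)
  define z where "z = Complex x y"
  have Re: "Re (z\<^sup>2) = - T" by (simp add: z_def power2_eq_square y[unfolded power2_eq_square])
  have "\<bar>even0 a x\<bar> + 1 = - a 1 * T" using a1 by (simp add: T_def)
  also have "\<dots> \<le> ser a (- T)" using growth T by simp
  also have "\<dots> \<le> cmod (ser a (z\<^sup>2))" using ser_norm_ge[OF assms(1), of "z\<^sup>2"] Re T by simp
  finally have 1: "\<bar>even0 a x\<bar> + 1 \<le> cmod (even0 a z)" by (simp add: even0_def)
  have "(cmod (even0 a z))\<^sup>2 \<le> (even0 a x)\<^sup>2"
    using even0_norm_le[OF assms(1), of z] nz L by (simp add: z_def)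
  hence "cmod (even0 a z) \<le> \<bar>even0 a x\<bar>"
    by (metis abs_le_square_iff abs_norm_cancel)
  with 1 show False by simp
qed

subsection \<open>Approximating the Bessel series by Laguerre polynomials\<close>

text \<open>Real counterpart of \<open>bessel_coeff\<close>: the coefficients in w = x^2 of
  \<open>S\<^sub>n\<close>, so \<open>even0 (bcoeff \<nu> n)\<close> is
  \<open>S\<^sub>n\<close>.\<close>

definition bcoeff :: "real \<Rightarrow> nat \<Rightarrow> nat \<Rightarrow> real" where
  "bcoeff \<nu> n m =
     (\<Prod>k<n. \<nu> - real k + 2 * real m) * ((-1) ^ m / (fact m * Gamma (\<nu> + real m + 1) * 4 ^ m))"

lemma bessel_coeff_eq: "bessel_coeff \<nu> n m = of_real (bcoeff \<nu> n m)"
proof -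
  have "Gamma (of_real \<nu> + of_nat m + 1) = complex_of_real (Gamma (\<nu> + real m + 1))"
    unfolding Gamma_complex_of_real[symmetric] by simp
  thus ?thesis by (simp add: bessel_coeff_def bcoeff_def)
qed

lemma entire_bcoeff: "entire_coeffs (bcoeff \<nu> n)"
  unfolding entire_coeffs_def
proof
  fix r :: real
  have "cmod (of_real r) < cmod (of_real (\<bar>r\<bar> + 1))" unfolding norm_of_real by linarith
  hence "summable (\<lambda>m. norm (bessel_coeff \<nu> n m * of_real r ^ m))"
    by (rule powser_insidea[OF summable_bessel_coeff])
  hence "summable (\<lambda>m. norm (\<bar>bcoeff \<nu> n m\<bar> * r ^ m))"
    by (simp add: bessel_coeff_eq norm_mult norm_power abs_mult power_abs)
  thus "summable (\<lambda>m. \<bar>bcoeff \<nu> n m\<bar> * r ^ m)" by (rule summable_norm_cancel)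
qed

lemma bcoeff_Suc: "bcoeff \<nu> (Suc n) m = (\<nu> - real n + 2 * real m) * bcoeff \<nu> n m"
  by (simp add: bcoeff_def mult_ac)

lemma bcoeff_sgn:
  assumes "\<nu> > real n - 1"
  shows "(-1) ^ m * bcoeff \<nu> n m > 0"
proof -
  have G: "Gamma (\<nu> + real m + 1) > 0" using assms by (intro Gamma_real_pos) linarith
  have P: "(\<Prod>k<n. \<nu> - real k + 2 * real m) > 0"
  proof (intro prod_pos)
    fix k assume "k \<in> {..<n}"
    hence "real k \<le> real n - 1" by auto
    thus "\<nu> - real k + 2 * real m > 0" using assms by linarith
  qed
  have "(-1) ^ m * bcoeff \<nu> n m =
      (\<Prod>k<n. \<nu> - real k + 2 * real m) / (fact m * Gamma (\<nu> + real m + 1) * 4 ^ m)"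
    by (simp add: bcoeff_def power_add[symmetric] mult.assoc[symmetric])
  also have "\<dots> > 0" using G P by (intro divide_pos_pos mult_pos_pos) auto
  finally show ?thesis .
qed

text \<open>This is the functional equation of \<open>Gamma\<close>, and the coefficient form of the
  equation 4 (w B'' + (\<nu> + 1) B') + B = 0 for \<open>S\<^sub>0\<close> = B(x^2).\<close>

lemma bcoeff_0_rec:
  assumes "\<nu> > -1"
  shows "4 * (real m + \<nu> + 1) * (real (Suc m) * bcoeff \<nu> 0 (Suc m)) + bcoeff \<nu> 0 m = 0"
proof -
  define s where "s = \<nu> + real m + 1"
  have s: "s > 0" using assms by (simp add: s_def)
  have "Gamma (s + 1) = s * Gamma s"
    by (rule Gamma_plus1) (use s in \<open>auto dest: nonpos_Ints_nonpos\<close>)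
  moreover have "Gamma s > 0" using s by (rule Gamma_real_pos)
  moreover have eqs: "\<nu> + real (Suc m) + 1 = s + 1" "\<nu> + real m + 1 = s" "real m + \<nu> + 1 = s"
    by (simp_all add: s_def)
  ultimately show ?thesis using s
    unfolding bcoeff_def eqs by (simp add: divide_simps del: of_nat_Suc)
qed

text \<open>
  The recurrence \<open>(N + 1) L\<^sub>N\<^sub>+\<^sub>1 = (N + 1 + \<nu> - x) L\<^sub>N + x L\<^sub>N'\<close> of the Laguerre polynomials, with \<open>x\<close>
  replaced by \<open>b x\<close> and normalised to keep the value at the origin.
\<close>

primrec laguerre_poly :: "real \<Rightarrow> real \<Rightarrow> nat \<Rightarrow> real poly" where
  "laguerre_poly \<nu> b 0 = [:1 / Gamma (\<nu> + 1):]"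
| "laguerre_poly \<nu> b (Suc N) = [:1, -(b / (real N + 1 + \<nu>)):] * laguerre_poly \<nu> b N +
     smult (1 / (real N + 1 + \<nu>)) ([:0, 1:] * pderiv (laguerre_poly \<nu> b N))"

lemma pos_rooted_laguerre_poly:
  assumes "\<nu> > -1" "b \<ge> 0"
  shows "pos_rooted (laguerre_poly \<nu> b N)"
proof (induction N)
  case 0
  have "Gamma (\<nu> + 1) > 0" using assms by (intro Gamma_real_pos) linarith
  thus ?case by (auto intro: pos_rooted.const)
next
  case (Suc N)
  thus ?case unfolding laguerre_poly.simps
    using assms by (intro pos_rooted_operator) auto
qed

text \<open>By induction on N: comparing coefficients reduces the recurrence to the identity
  \<open>key\<close>, which combines Pascal's rule with absorption.\<close>

lemma coeff_laguerre_poly: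
  assumes "\<nu> > -1"
  shows "coeff (laguerre_poly \<nu> b N) m =
    real (N choose m) * (-b) ^ m / Gamma (\<nu> + real m + 1)"
proof (induction N arbitrary: m)
  case 0
  thus ?case by (cases m) auto
next
  case (Suc N)
  define s where "s = real N + 1 + \<nu>"
  have s: "s > 0" using assms by (simp add: s_def)
  show ?case
  proof (cases m)
    case 0
    thus ?thesis using Suc.IH[of 0] by simp
  next
    case (Suc k)
    define g where "g = \<nu> + real k + 1"
    define A B where "A = real (N choose k)" and "B = real (N choose Suc k)"
    have g: "g > 0" using assms by (simp add: g_def)
    have G: "Gamma (g + 1) = g * Gamma g"
      by (rule Gamma_plus1) (use g in \<open>auto dest: nonpos_Ints_nonpos\<close>)
    have G0: "Gamma g > 0" using g by (rule Gamma_real_pos)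
    have "Suc N * (N choose k) = (Suc N choose Suc k) * Suc k" by (rule Suc_times_binomial_eq)
    hence "real (Suc N * (N choose k)) = real ((Suc N choose Suc k) * Suc k)" by (rule arg_cong)
    hence "(real N + 1) * A = (A + B) * (real k + 1)"
      by (simp add: A_def B_def algebra_simps)
    hence key: "s * (A + B) = (s + real k + 1) * B + g * A"
      by (simp add: s_def g_def algebra_simps)
    have c1: "coeff (laguerre_poly \<nu> b N) k = A * (-b) ^ k / Gamma g"
      by (simp add: Suc.IH A_def g_def)
    have c2: "coeff (laguerre_poly \<nu> b N) (Suc k) = B * (-b) ^ Suc k / (g * Gamma g)"
      unfolding Suc.IH B_def G[symmetric] by (simp add: g_def add_ac)
    have "coeff (laguerre_poly \<nu> b (Suc N)) (Suc k) =
        coeff (laguerre_poly \<nu> b N) (Suc k) - b / s * coeff (laguerre_poly \<nu> b N) k +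
        1 / s * (real (Suc k) * coeff (laguerre_poly \<nu> b N) (Suc k))"
      by (simp add: coeff_pderiv s_def)
    also have "\<dots> = (-b) ^ Suc k * ((s + real k + 1) * B + g * A) / (s * (g * Gamma g))"
      unfolding c1 c2 using s g G0 by (simp add: divide_simps) (simp add: algebra_simps)
    also have "\<dots> = (A + B) * (-b) ^ Suc k / Gamma (g + 1)"
      unfolding key[symmetric] G using s by simp
    finally show ?thesis by (simp add: Suc A_def B_def g_def add_ac)
  qed
qed

text \<open>In w = x^2 the step from k to k + 1 corresponds to differentiating x^(\<nu> - k)
  \<open>S\<^sub>k\<close>(x). The coefficient -0 makes the term an instance of
  \<open>pos_rooted_operator\<close>.\<close>

primrec euler_op :: "real \<Rightarrow> nat \<Rightarrow> real poly \<Rightarrow> real poly" where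
  "euler_op \<nu> 0 p = p"
| "euler_op \<nu> (Suc n) p = [:\<nu> - real n, -0:] * euler_op \<nu> n p + smult 2 ([:0, 1:] * pderiv (euler_op \<nu> n p))"

text \<open>The bound on \<nu> makes \<nu> - k positive for every k < n, as
  \<open>pos_rooted_operator\<close> demands.\<close>

lemma pos_rooted_euler_op:
  assumes "\<nu> > real n - 1" "pos_rooted p"
  shows "pos_rooted (euler_op \<nu> n p)"
  using assms
proof (induction n)
  case (Suc n)
  thus ?case unfolding euler_op.simps by (intro pos_rooted_operator Suc.IH) auto
qed simp

lemma coeff_euler_op: "coeff (euler_op \<nu> n p) m = (\<Prod>k<n. \<nu> - real k + 2 * real m) * coeff p m"
proof (induction n)
  case (Suc n)
  have "coeff (euler_op \<nu> (Suc n) p) m = (\<nu> - real n + 2 * real m) * coeff (euler_op \<nu> n p) m"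
    by (cases m) (auto simp: coeff_pderiv algebra_simps)
  thus ?case by (simp add: Suc.IH mult_ac)
qed simp

text \<open>With K = N + 1 the quotient is the product of 1 - j / K over j < m; the induction
  appends the factor j = m.\<close>

lemma binomial_fact_over_power_tendsto:
  "(\<lambda>N. real (Suc N choose m) * fact m / real (Suc N) ^ m) \<longlonglongrightarrow> 1"
proof (induction m)
  case (Suc m)
  have "(\<lambda>N. real (Suc N choose m) * fact m / real (Suc N) ^ m * (1 - real m / real (Suc N)))
      \<longlonglongrightarrow> 1 * (1 - 0)"
    by (intro tendsto_intros Suc.IH real_tendsto_divide_at_top[OF tendsto_const]
          filterlim_compose[OF filterlim_real_sequentially filterlim_Suc])
  moreover have "real (Suc N choose Suc m) * fact (Suc m) / real (Suc N) ^ Suc m =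
      real (Suc N choose m) * fact m / real (Suc N) ^ m * (1 - real m / real (Suc N))" for N
  proof -
    define K where "K = Suc N"
    have "Suc K * (K choose m) = (Suc K choose Suc m) * Suc m" by (rule Suc_times_binomial_eq)
    hence "real (Suc K * (K choose m)) = real ((Suc K choose Suc m) * Suc m)" by (rule arg_cong)
    hence *: "real (K choose Suc m) * (real m + 1) = (real K - real m) * real (K choose m)"
      by (simp add: algebra_simps)
    have "real (K choose Suc m) * fact (Suc m) / real K ^ Suc m =
        real (K choose Suc m) * (real m + 1) * fact m / (real K * real K ^ m)"
      by (simp add: mult_ac)
    also have "\<dots> = real (K choose m) * fact m / real K ^ m * (1 - real m / real K)"
      unfolding * by (simp add: K_def divide_simps del: of_nat_Suc)
    finally show ?thesis unfolding K_def .
  qed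
  ultimately show ?case by simp
qed simp

lemma pos_limit_bcoeff:
  assumes "\<nu> > real n - 1"
  shows "pos_limit (bcoeff \<nu> n)"
  unfolding pos_limit_def
proof (intro conjI exI allI)
  \<comment> \<open>Scaling the argument by 1 / (4 K), K = N + 1, produces the 4^m of the Bessel
    series and leaves the multiplier binomial(K, m) m! / K^m.\<close>
  let ?p = "\<lambda>N. euler_op \<nu> n (laguerre_poly \<nu> (1 / (4 * real (Suc N))) (Suc N))"
  let ?\<theta> = "\<lambda>N m. real (Suc N choose m) * fact m / real (Suc N) ^ m"
  have \<nu>: "\<nu> > -1" using assms by linarith
  show "entire_coeffs (bcoeff \<nu> n)" by (rule entire_bcoeff)
  show "pos_rooted (?p N)" for N
    by (intro pos_rooted_euler_op pos_rooted_laguerre_poly assms \<nu>) auto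
  show "(\<lambda>N. ?\<theta> N m) \<longlonglongrightarrow> 1" for m by (rule binomial_fact_over_power_tendsto)
  show "\<bar>?\<theta> N m\<bar> \<le> 1" for N m
  proof -
    have "real ((Suc N choose m) * fact m) \<le> real (Suc N ^ m)"
      by (intro of_nat_mono binomial_fact_pow)
    thus ?thesis by (simp add: divide_simps del: of_nat_Suc binomial_Suc_Suc)
  qed
  show "coeff (?p N) m = bcoeff \<nu> n m * ?\<theta> N m" for N m
    unfolding coeff_euler_op coeff_laguerre_poly[OF \<nu>] bcoeff_def
    by (simp add: power_mult_distrib power_divide power_minus[of "1 / _"] divide_simps
          del: of_nat_Suc binomial_Suc_Suc power_Suc)
qed

section \<open>The recurrence in n and Bessel's differential equation\<close>

lemma ser_euler:
  fixes z :: "'a::{real_normed_field,banach}"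
  assumes "entire_coeffs a"
  shows "(\<lambda>m. of_real (real m * a m) * z ^ m) sums (z * ser (diffs a) z)"
proof -
  have sm: "summable (\<lambda>m. diffs (\<lambda>m. of_real (a m)) m * z ^ m)"
    by (intro termdiff_converges_all summable_ser assms)
  have d: "diffs (\<lambda>m. of_real (a m)) m = (of_real (diffs a m) :: 'a)" for m
    by (simp add: diffs_def)
  have "(\<lambda>m. z * (of_nat m * of_real (a m) * z ^ (m - Suc 0))) sums
      (z * (\<Sum>m. diffs (\<lambda>m. of_real (a m)) m * z ^ m))"
    by (intro sums_mult diffs_equiv sm)
  moreover have "z * (of_nat m * of_real (a m) * z ^ (m - Suc 0)) = of_real (real m * a m) * z ^ m" for m
    by (cases m) auto
  ultimately show ?thesis unfolding d ser_def by simp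
qed

lemma ser_sums:
  "entire_coeffs a \<Longrightarrow> (\<lambda>m. of_real (a m) * z ^ m) sums ser a z"
  unfolding ser_def by (intro summable_sums summable_ser)

lemma ser_bcoeff_Suc:
  fixes z :: "'a::{real_normed_field,banach}"
  shows "ser (bcoeff \<nu> (Suc n)) z =
    of_real (\<nu> - real n) * ser (bcoeff \<nu> n) z + 2 * (z * ser (diffs (bcoeff \<nu> n)) z)"
proof -
  have "(\<lambda>m. of_real (\<nu> - real n) * (of_real (bcoeff \<nu> n m) * z ^ m) +
      2 * (of_real (real m * bcoeff \<nu> n m) * z ^ m)) sums
     (of_real (\<nu> - real n) * ser (bcoeff \<nu> n) z + 2 * (z * ser (diffs (bcoeff \<nu> n)) z))"
    by (intro sums_add sums_mult ser_sums ser_euler entire_bcoeff)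
  thus ?thesis unfolding ser_def[of "bcoeff \<nu> (Suc n)"]
    by (intro sums_unique[symmetric]) (simp add: bcoeff_Suc algebra_simps)
qed

text \<open>Up to a power of z, this is the derivative of z^(\<nu> - n)
  \<open>S\<^sub>n\<close>(z).\<close>

lemma even0_bcoeff_Suc:
  "even0 (bcoeff \<nu> (Suc n)) z = of_real (\<nu> - real n) * even0 (bcoeff \<nu> n) z + z * even1 (bcoeff \<nu> n) z"
  unfolding even0_def even1_def ser_bcoeff_Suc by (simp add: power2_eq_square)

lemma even1_bcoeff_Suc:
  fixes x :: real
  shows "even1 (bcoeff \<nu> (Suc n)) x =
    (\<nu> - real n + 1) * even1 (bcoeff \<nu> n) x + x * even2 (bcoeff \<nu> n) x"
proof -
  have "((\<lambda>x. (\<nu> - real n) * even0 (bcoeff \<nu> n) x + x * even1 (bcoeff \<nu> n) x)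
      has_field_derivative (\<nu> - real n) * even1 (bcoeff \<nu> n) x +
        (1 * even1 (bcoeff \<nu> n) x + even2 (bcoeff \<nu> n) x * x)) (at x)"
    by (intro DERIV_add DERIV_cmult DERIV_mult DERIV_ident DERIV_even0 DERIV_even1 entire_bcoeff)
  moreover have "(\<lambda>x. (\<nu> - real n) * even0 (bcoeff \<nu> n) x + x * even1 (bcoeff \<nu> n) x) =
      even0 (bcoeff \<nu> (Suc n))"
    by (simp add: fun_eq_iff even0_bcoeff_Suc)
  ultimately have "(even0 (bcoeff \<nu> (Suc n)) has_field_derivative (\<nu> - real n) * even1 (bcoeff \<nu> n) x +
        (1 * even1 (bcoeff \<nu> n) x + even2 (bcoeff \<nu> n) x * x)) (at x)" by simp
  from DERIV_unique[OF DERIV_even0[OF entire_bcoeff] this] show ?thesis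
    by (simp add: algebra_simps)
qed

text \<open>Bessel's equation after the substitution J = x^\<nu> u with the power divided out. It is
  verified termwise in w = x^2 through \<open>bcoeff_0_rec\<close>.\<close>

lemma bessel_ode:
  fixes x :: real
  assumes "\<nu> > -1"
  shows "x * even2 (bcoeff \<nu> 0) x + (2 * \<nu> + 1) * even1 (bcoeff \<nu> 0) x + x * even0 (bcoeff \<nu> 0) x = 0"
proof -
  define b where "b = bcoeff \<nu> 0"
  have e: "entire_coeffs b" unfolding b_def by (rule entire_bcoeff)
  note e1 = entire_coeffs_diffs[OF e]
  have "(\<lambda>m. 4 * (of_real (real m * diffs b m) * w ^ m) + 4 * (\<nu> + 1) * (of_real (diffs b m) * w ^ m) +
      of_real (b m) * w ^ m) sums
      (4 * (w * ser (diffs (diffs b)) w) + 4 * (\<nu> + 1) * ser (diffs b) w + ser b w)" for w :: real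
    by (intro sums_add sums_mult ser_sums ser_euler e e1)
  moreover have "4 * (of_real (real m * diffs b m) * w ^ m) + 4 * (\<nu> + 1) * (of_real (diffs b m) * w ^ m) +
      of_real (b m) * w ^ m = 0" for m and w :: real
  proof -
    have "4 * (of_real (real m * diffs b m) * w ^ m) + 4 * (\<nu> + 1) * (of_real (diffs b m) * w ^ m) +
      of_real (b m) * w ^ m =
      (4 * (real m + \<nu> + 1) * (real (Suc m) * bcoeff \<nu> 0 (Suc m)) + bcoeff \<nu> 0 m) * w ^ m"
      unfolding diffs_def b_def of_real_eq_id id_apply by (simp add: algebra_simps del: of_nat_Suc)
    thus ?thesis unfolding bcoeff_0_rec[OF assms] by simp
  qed
  ultimately have "4 * (w * ser (diffs (diffs b)) w) + 4 * (\<nu> + 1) * ser (diffs b) w + ser b w = 0"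
    for w :: real using sums_unique2[OF _ sums_zero] by (metis (no_types, lifting) sums_cong)
  from arg_cong[OF this[of "x\<^sup>2"], of "\<lambda>t. x * t"] show ?thesis
    unfolding even0_def even1_def even2_def b_def[symmetric] by (simp add: algebra_simps)
qed

subsection \<open>The strict Laguerre inequality\<close>

lemma even_minus:
  "even0 a (- z) = even0 a z" "even1 a (- z) = - even1 a z"
  by (simp_all add: even0_def even1_def)

text \<open>A common zero of u and u' at y > 0 would force u to vanish on (0, y) and hence at the
  origin, where its value is 1 / Gamma (\<nu> + 1). Parity handles negative x.\<close>

lemma bessel_simple_zeros:
  fixes x :: real
  assumes "\<nu> > -1" and z: "even0 (bcoeff \<nu> 0) x = 0"
  shows "even1 (bcoeff \<nu> 0) x \<noteq> 0"
proof -
  define u u1 u2 :: "real \<Rightarrow> real"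
    where "u = even0 (bcoeff \<nu> 0)" and "u1 = even1 (bcoeff \<nu> 0)" and "u2 = even2 (bcoeff \<nu> 0)"
  have D: "(u has_real_derivative u1 t) (at t)" "(u1 has_real_derivative u2 t) (at t)" for t
    unfolding u_def u1_def u2_def by (rule DERIV_even0 DERIV_even1, rule entire_bcoeff)+
  have ode: "t * u2 t = - (2 * \<nu> + 1) * u1 t - t * u t" for t
    using bessel_ode[OF assms(1), of t] by (simp add: u_def u1_def u2_def algebra_simps)
  have u0: "u 0 \<noteq> 0"
    using bcoeff_sgn[of 0 \<nu> 0] assms by (simp add: u_def even0_def ser_0)
  have pos: False if y: "y > 0" "u y = 0" "u1 y = 0" for y
  proof -
    \<comment> \<open>This size of k keeps the coefficient of u1^2 in the derivative of E
      nonnegative.\<close>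
    obtain k where k: "real k \<ge> 2 * \<bar>2 * \<nu> + 1\<bar>" using real_arch_simple by blast
    \<comment> \<open>Up to the power of \<open>t\<close>, which makes it nondecreasing, this is the energy of the equation.\<close>
    define E where "E t = t ^ Suc k * ((u t)\<^sup>2 + (u1 t)\<^sup>2)" for t
    have "u t = 0" if t: "0 < t" "t < y" for t
    proof -
      have "E t \<le> E y"
      proof (rule DERIV_nonneg_imp_nondecreasing[of t y E])
        fix r assume "t \<le> r" "r \<le> y"
        hence r: "r > 0" using t by simp
        let ?d = "(real (Suc k) * r ^ k) * ((u r)\<^sup>2 + (u1 r)\<^sup>2) +
            (2 * u r * u1 r + 2 * u1 r * u2 r) * r ^ Suc k"
        have "(E has_real_derivative ?d) (at r)"
          unfolding E_def
          by (rule derivative_eq_intros D refl | simp add: algebra_simps)+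
        moreover have "?d \<ge> 0"
        proof -
          have "?d = r ^ k * (real (Suc k) * ((u r)\<^sup>2 + (u1 r)\<^sup>2) + 2 * u1 r * (r * u r + r * u2 r))"
            by (simp add: algebra_simps)
          also have "r * u r + r * u2 r = - (2 * \<nu> + 1) * u1 r" using ode[of r] by simp
          also have "real (Suc k) * ((u r)\<^sup>2 + (u1 r)\<^sup>2) + 2 * u1 r * (- (2 * \<nu> + 1) * u1 r) =
              real (Suc k) * (u r)\<^sup>2 + (real k + 1 - 2 * (2 * \<nu> + 1)) * (u1 r)\<^sup>2"
            by (simp add: algebra_simps power2_eq_square)
          finally have d: "?d = r ^ k * (real (Suc k) * (u r)\<^sup>2 + (real k + 1 - 2 * (2 * \<nu> + 1)) * (u1 r)\<^sup>2)" .
          have "real k + 1 - 2 * (2 * \<nu> + 1) \<ge> 0" using k abs_ge_self[of "2 * \<nu> + 1"] by argo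
          thus ?thesis unfolding d using r by (intro mult_nonneg_nonneg add_nonneg_nonneg) auto
        qed
        ultimately show "\<exists>d. (E has_real_derivative d) (at r) \<and> 0 \<le> d" by blast
      qed (use t in simp)
      also have "E y = 0" using y by (simp add: E_def)
      finally have "t ^ Suc k * ((u t)\<^sup>2 + (u1 t)\<^sup>2) \<le> 0" by (simp add: E_def)
      moreover have "t ^ Suc k > 0" using t by simp
      ultimately have "(u t)\<^sup>2 + (u1 t)\<^sup>2 \<le> 0" unfolding mult_le_0_iff by linarith
      thus "u t = 0" by (simp add: sum_power2_le_zero_iff)
    qed
    hence "\<forall>\<^sub>F t in at_right 0. u t = 0"
      using eventually_at_right_real[OF y(1)] by (auto elim: eventually_mono)
    hence "(u \<longlongrightarrow> 0) (at_right 0)" by (rule tendsto_eventually)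
    moreover have "(u \<longlongrightarrow> u 0) (at_right 0)"
      using DERIV_isCont[OF D(1)[of 0]] by (auto simp: isCont_def intro: tendsto_within_subset)
    ultimately show False using u0 tendsto_unique[of "at_right (0::real)"] by force
  qed
  show ?thesis
  proof
    assume z1: "even1 (bcoeff \<nu> 0) x = 0"
    consider "x > 0" | "x = 0" | "- x > 0" by linarith
    thus False
    proof cases
      case 1 thus ?thesis using pos[of x] z z1 by (simp add: u_def u1_def)
    next
      case 2 thus ?thesis using z u0 by (simp add: u_def)
    next
      case 3 thus ?thesis using pos[of "- x"] z z1 by (simp add: u_def u1_def even_minus)
    qed
  qed
qed

text \<open>Only zeros need the induction, and there the claim says that the derivative is
  nonzero.\<close>

lemma even_laguerre_pos:
  assumes "\<nu> > real n - 1"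
  shows "even_laguerre (bcoeff \<nu> n) x > 0"
  using assms
proof (induction n arbitrary: x)
  case 0
  show ?case
  proof (cases "even0 (bcoeff \<nu> 0) x = 0")
    case True
    thus ?thesis using bessel_simple_zeros[of \<nu> x] 0 by (simp add: even_laguerre_def)
  next
    case False
    thus ?thesis using 0 by (intro even_laguerre_pos_nonzero pos_limit_bcoeff bcoeff_sgn) auto
  qed
next
  case (Suc n)
  show ?case
  proof (cases "even0 (bcoeff \<nu> (Suc n)) x = 0")
    case False
    thus ?thesis using Suc.prems by (intro even_laguerre_pos_nonzero pos_limit_bcoeff bcoeff_sgn) auto
  next
    case True
    define a where "a = \<nu> - real n"
    have a: "a > 0" using Suc.prems by (simp add: a_def)
    define e e1 e2 where "e = even0 (bcoeff \<nu> n) x" and "e1 = even1 (bcoeff \<nu> n) x"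
      and "e2 = even2 (bcoeff \<nu> n) x"
    have L: "e1\<^sup>2 - e * e2 > 0" using Suc.IH[of x] Suc.prems by (simp add: even_laguerre_def e_def e1_def e2_def)
    have z: "a * e + x * e1 = 0" using True by (simp add: even0_bcoeff_Suc a_def e_def e1_def)
    have "x \<noteq> 0"
    proof
      assume "x = 0"
      hence "even0 (bcoeff \<nu> (Suc n)) x = bcoeff \<nu> (Suc n) 0" by (simp add: even0_def ser_0)
      thus False using True bcoeff_sgn[of "Suc n" \<nu> 0] Suc.prems by simp
    qed
    \<comment> \<open>At a zero of \<open>S\<^sub>n\<^sub>+\<^sub>1\<close> one has x e1 = -a e.
      This expresses e x times its derivative through the Laguerre expression of
      \<open>S\<^sub>n\<close>, and shows it negative.\<close>
    have eq: "e * x * ((a + 1) * e1 + x * e2) = - a * e\<^sup>2 - x\<^sup>2 * (e1\<^sup>2 - e * e2)"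
    proof -
      have xe: "x * e1 = - a * e" using z by simp
      have "e * x * ((a + 1) * e1 + x * e2) + x\<^sup>2 * (e1\<^sup>2 - e * e2) = (a + 1) * e * (x * e1) + (x * e1)\<^sup>2"
        by (simp add: algebra_simps power2_eq_square)
      also have "\<dots> = - a * e\<^sup>2" unfolding xe by (simp add: algebra_simps power2_eq_square)
      finally show ?thesis by simp
    qed
    have "x\<^sup>2 * (e1\<^sup>2 - e * e2) > 0" using L \<open>x \<noteq> 0\<close> by simp
    moreover have "a * e\<^sup>2 \<ge> 0" using a by simp
    ultimately have "e * x * ((a + 1) * e1 + x * e2) \<noteq> 0" unfolding eq by linarith
    hence "even1 (bcoeff \<nu> (Suc n)) x \<noteq> 0"
      by (auto simp: even1_bcoeff_Suc a_def e1_def e2_def)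
    thus ?thesis using True by (simp add: even_laguerre_def)
  qed
qed

subsection \<open>Infinitude of the zeros\<close>

lemma has_real_derivative_powr_mult:
  fixes f :: "real \<Rightarrow> real"
  assumes "x > 0" "(f has_real_derivative d) (at x)"
  shows "((\<lambda>x. x powr p * f x) has_real_derivative x powr p * (p * f x / x + d)) (at x)"
proof -
  have "((\<lambda>x. x powr p * f x) has_real_derivative (p * x powr (p - 1)) * f x + d * x powr p) (at x)"
    by (rule DERIV_mult[OF has_real_derivative_powr[OF assms(1)] assms(2)])
  moreover have "x powr (p - 1) = x powr p / x" using assms(1) by (simp add: powr_diff)
  ultimately show ?thesis by (simp add: field_simps)
qed

text \<open>Unboundedness is the form that the induction preserves: Rolle's theorem for x^(\<nu> -
  n) \<open>S\<^sub>n\<close> between two zeros beyond X gives a zero of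
  \<open>S\<^sub>n\<^sub>+\<^sub>1\<close> beyond X.\<close>

lemma bessel_zeros_unbounded:
  assumes "\<nu> > real n - 1"
  shows "\<exists>x > X. even0 (bcoeff \<nu> n) x = (0 :: real)"
  using assms
proof (induction n arbitrary: X)
  case 0
  define u u1 u2 :: "real \<Rightarrow> real"
    where "u = even0 (bcoeff \<nu> 0)" and "u1 = even1 (bcoeff \<nu> 0)" and "u2 = even2 (bcoeff \<nu> 0)"
  have D: "(u has_real_derivative u1 t) (at t)" "(u1 has_real_derivative u2 t) (at t)" for t
    unfolding u_def u1_def u2_def by (rule DERIV_even0 DERIV_even1, rule entire_bcoeff)+
  have ode: "t * u2 t = - (2 * \<nu> + 1) * u1 t - t * u t" for t
    using bessel_ode[of \<nu> t] 0 by (simp add: u_def u1_def u2_def algebra_simps)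
  show ?case
  proof (rule ccontr)
    assume "\<not> ?case"
    hence nz: "u x \<noteq> 0" if "x > X" for x using that by (auto simp: u_def)
    \<comment> \<open>Beyond Y there are no zeros and the coefficient (2 \<nu> + 1) / x has modulus
      at most 1.\<close>
    define Y where "Y = max X \<bar>2 * \<nu> + 1\<bar> + 1"
    \<comment> \<open>By the equation, \<open>G = - u1 / u\<close> satisfies a Riccati equation forcing \<open>G' \<ge> (1 + G\<^sup>2) / 2\<close>.\<close>
    define h where "h x = arctan (- u1 x / u x) - x / 2" for x
    \<comment> \<open>Over length 8 the arctangent would have to grow by at least 4, but its range
      is shorter than pi < 4.\<close>
    have "h Y \<le> h (Y + 8)"
    proof (rule DERIV_nonneg_imp_nondecreasing[of Y "Y + 8" h])
      fix x assume x: "Y \<le> x" "x \<le> Y + 8"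
      have ux: "u x \<noteq> 0" using nz x by (simp add: Y_def)
      have x0: "x > 0" "x \<ge> \<bar>2 * \<nu> + 1\<bar>" using x by (auto simp: Y_def)
      define G where "G = - u1 x / u x"
      define G' where "G' = (- u2 x * u x - (- u1 x) * u1 x) / (u x * u x)"
      have "((\<lambda>x. - u1 x / u x) has_real_derivative G') (at x)"
        unfolding G'_def by (rule DERIV_divide[OF DERIV_minus[OF D(2)] D(1) ux])
      hence dh: "(h has_real_derivative inverse (1 + G\<^sup>2) * G' - 1 / 2) (at x)"
        unfolding h_def G_def
        by (intro DERIV_diff DERIV_cdivide DERIV_ident DERIV_chain2[OF DERIV_arctan])
      have u2: "u2 x = - (2 * \<nu> + 1) * u1 x / x - u x" using ode[of x] x0 by (simp add: field_simps)
      have G': "G' = 1 + G\<^sup>2 - (2 * \<nu> + 1) / x * G"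
        unfolding G'_def G_def u2 using ux x0 by (simp add: field_simps power2_eq_square)
      have "(2 * \<nu> + 1) / x * G \<le> \<bar>(2 * \<nu> + 1) / x\<bar> * \<bar>G\<bar>"
        unfolding abs_mult[symmetric] by (rule abs_ge_self)
      also have "\<dots> \<le> 1 * \<bar>G\<bar>" using x0 by (intro mult_right_mono) auto
      also have "\<dots> \<le> (1 + G\<^sup>2) / 2"
        using zero_le_power2[of "\<bar>G\<bar> - 1"] by (simp add: power2_diff)
      finally have "G' \<ge> (1 + G\<^sup>2) / 2" unfolding G' by simp
      moreover have "1 + G\<^sup>2 > 0" by (simp add: add_pos_nonneg)
      ultimately have "inverse (1 + G\<^sup>2) * G' - 1 / 2 \<ge> 0" by (simp add: field_simps)
      thus "\<exists>y. (h has_real_derivative y) (at x) \<and> 0 \<le> y" using dh by blast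
    qed simp
    hence "arctan (- u1 (Y + 8) / u (Y + 8)) - arctan (- u1 Y / u Y) \<ge> 4"
      by (simp add: h_def add_divide_distrib)
    thus False
      using arctan_bounded[of "- u1 (Y + 8) / u (Y + 8)"] arctan_bounded[of "- u1 Y / u Y"] pi_less_4
      by linarith
  qed
next
  case (Suc n)
  have "\<nu> > real n - 1" using Suc.prems by simp
  note IH = Suc.IH[OF this]
  obtain a where a: "a > max X 0" "even0 (bcoeff \<nu> n) a = 0" using IH by blast
  obtain b where b: "b > a" "even0 (bcoeff \<nu> n) b = 0" using IH by blast
  let ?p = "\<nu> - real n"
  let ?f = "\<lambda>x. x powr ?p * even0 (bcoeff \<nu> n) x"
  have D: "(?f has_real_derivative
      x powr ?p * (?p * even0 (bcoeff \<nu> n) x / x + even1 (bcoeff \<nu> n) x)) (at x)" if "x \<ge> a" for x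
    using that a by (intro has_real_derivative_powr_mult DERIV_even0 entire_bcoeff) auto
  \<comment> \<open>\<open>Rolle_deriv\<close> returns the derivative as a zero linear map;
    evaluating it at 1 gives the equation.\<close>
  have "\<exists>z>a. z < b \<and> (\<lambda>v. (z powr ?p * (?p * even0 (bcoeff \<nu> n) z / z + even1 (bcoeff \<nu> n) z)) * v) = (\<lambda>v. 0)"
  proof (rule Rolle_deriv)
    show "continuous_on {a..b} ?f"
      using D by (intro DERIV_continuous_on[of _ _ "\<lambda>x. x powr ?p * (?p * even0 (bcoeff \<nu> n) x / x + even1 (bcoeff \<nu> n) x)"])
        (auto intro: has_field_derivative_at_within)
  qed (use a b D in \<open>auto simp: has_field_derivative_def\<close>)
  then obtain z where z: "a < z" "z powr ?p * (?p * even0 (bcoeff \<nu> n) z / z + even1 (bcoeff \<nu> n) z) = 0"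
    by (metis mult.right_neutral)
  have "?p * even0 (bcoeff \<nu> n) z / z + even1 (bcoeff \<nu> n) z = 0"
    using z a by simp
  hence "even0 (bcoeff \<nu> (Suc n)) z = 0"
    using z(1) a by (simp add: even0_bcoeff_Suc field_simps)
  thus ?case using z a by (intro exI[of _ z]) auto
qed

subsection \<open>Interlacing\<close>

text \<open>The difference quotient tends to d, which is nonzero, so f has no other zero near
  x.\<close>

lemma isolated_in_simple_zeros:
  fixes f :: "real \<Rightarrow> real"
  assumes "(f has_real_derivative d) (at x)" "d \<noteq> 0" "f x = 0" "x \<in> I"
  shows "x isolated_in {x\<in>I. f x = 0}"
  unfolding isolated_in_altdef
proof
  have "((\<lambda>y. (f y - f x) / (y - x)) \<longlongrightarrow> d) (at x)"
    using assms(1) by (simp add: has_field_derivative_iff)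
  from tendsto_imp_eventually_ne[OF this assms(2)] show "\<forall>\<^sub>F y in at x. y \<notin> {x\<in>I. f x = 0}"
    by eventually_elim (use assms(3) in auto)
qed (use assms in simp)

lemma interlace_sym: "interlace A B \<Longrightarrow> interlace B A"
  by (auto simp: interlace_def)

text \<open>Rolle puts a zero of v between zeros of u. Conversely -v/u increases strictly wherever u
  is nonzero, so it cannot vanish at both ends of an interval free of zeros of u. Each existence
  statement gives uniqueness in the other direction.\<close>

lemma interlace_deriv_zeros:
  fixes u v w :: "real \<Rightarrow> real"
  assumes I: "is_interval I"
    and u: "\<And>x. x \<in> I \<Longrightarrow> (u has_real_derivative v x) (at x)"
    and v: "\<And>x. x \<in> I \<Longrightarrow> (v has_real_derivative w x) (at x)"
    and L: "\<And>x. x \<in> I \<Longrightarrow> (v x)\<^sup>2 - u x * w x > 0"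
  shows "interlace {x\<in>I. u x = 0} {x\<in>I. v x = 0}"
proof -
  have sub: "{a..b} \<subseteq> I" if "a \<in> I" "b \<in> I" for a b
    using that I unfolding is_interval_1 subset_iff atLeastAtMost_iff by blast
  have rolle: "\<exists>c. a < c \<and> c < b \<and> c \<in> I \<and> v c = 0"
    if ab: "a \<in> I" "b \<in> I" "a < b" "u a = 0" "u b = 0" for a b
  proof -
    have D: "(u has_real_derivative v x) (at x)" if "a \<le> x" "x \<le> b" for x
      using that u sub[OF ab(1,2)] by auto
    have "\<exists>z>a. z < b \<and> (\<lambda>t. v z * t) = (\<lambda>t. 0)"
    proof (rule Rolle_deriv)
      show "continuous_on {a..b} u"
        using D by (intro DERIV_continuous_on[of _ _ v]) (auto intro: has_field_derivative_at_within)
    qed (use ab D in \<open>auto simp: has_field_derivative_def\<close>)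
    then obtain z where "a < z" "z < b" "v z = 0" by (metis mult.right_neutral)
    thus ?thesis using sub[OF ab(1,2)] by (intro exI[of _ z]) auto
  qed
  have mono: "\<exists>c\<ge>a. c \<le> b \<and> u c = 0" if ab: "a \<in> I" "b \<in> I" "a < b" "v a = 0" "v b = 0" for a b
  proof (rule ccontr)
    assume "\<not> ?thesis"
    hence nz: "u c \<noteq> 0" if "a \<le> c" "c \<le> b" for c using that by auto
    have "- v a / u a < - v b / u b"
    proof (rule DERIV_pos_imp_increasing[OF ab(3)])
      fix x assume x: "a \<le> x" "x \<le> b"
      hence xI: "x \<in> I" using sub[OF ab(1,2)] by auto
      have "((\<lambda>x. - v x / u x) has_real_derivative (- w x * u x - (- v x) * v x) / (u x * u x)) (at x)"
        by (rule DERIV_divide[OF DERIV_minus[OF v[OF xI]] u[OF xI] nz[OF x]])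
      moreover have "(- w x * u x - (- v x) * v x) / (u x * u x) > 0"
        using L[OF xI] nz[OF x]
        by (intro divide_pos_pos) (simp_all add: power2_eq_square mult.commute, metis not_real_square_gt_zero)
      ultimately show "\<exists>y. ((\<lambda>x. - v x / u x) has_real_derivative y) (at x) \<and> 0 < y" by blast
    qed
    thus False using ab by simp
  qed
  show ?thesis
    unfolding interlace_def
  proof (intro conjI)
    show "discrete {x\<in>I. u x = 0}"
      by (rule discreteI, clarify, rule isolated_in_simple_zeros[OF u]) (use L in force)+
    show "discrete {x\<in>I. v x = 0}"
      by (rule discreteI, clarify, rule isolated_in_simple_zeros[OF v]) (use L in force)+
    show "{x\<in>I. u x = 0} \<inter> {x\<in>I. v x = 0} = {}"
      using L by force
    show "one_between {x\<in>I. u x = 0} {x\<in>I. v x = 0}"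
      unfolding one_between_def
    proof (intro ballI impI)
      fix a b assume ab: "a \<in> {x\<in>I. u x = 0}" "b \<in> {x\<in>I. u x = 0}"
        and cons: "a < b \<and> {x\<in>I. u x = 0} \<inter> {a<..<b} = {}"
      obtain c where c: "a < c" "c < b" "c \<in> I" "v c = 0" using rolle ab cons by blast
      have uniq: "d = e" if "d \<in> I" "v d = 0" "a < d" "d < b" "e \<in> I" "v e = 0" "a < e" "e < b" for d e
      proof (rule ccontr)
        assume "d \<noteq> e"
        \<comment> \<open>Two zeros of v would enclose a zero of u strictly inside (a, b), although
          a and b are consecutive.\<close>
        hence "\<exists>c\<ge>min d e. c \<le> max d e \<and> u c = 0"
          using mono[of d e] mono[of e d] that by (cases "d < e") (auto simp: min_def max_def)
        then obtain f where f: "min d e \<le> f" "f \<le> max d e" "u f = 0" by blast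
        moreover have "f \<in> I" using f sub[of "min d e" "max d e"] that by (auto simp: min_def max_def split: if_splits)
        moreover have "a < f" "f < b" using f that by auto
        ultimately show False using cons by auto
      qed
      show "\<exists>!c. c \<in> {x\<in>I. v x = 0} \<and> a < c \<and> c < b"
        by (rule ex1I[of _ c]) (use c uniq in simp_all)
    qed
    show "one_between {x\<in>I. v x = 0} {x\<in>I. u x = 0}"
      unfolding one_between_def
    proof (intro ballI impI)
      fix a b assume ab: "a \<in> {x\<in>I. v x = 0}" "b \<in> {x\<in>I. v x = 0}"
        and cons: "a < b \<and> {x\<in>I. v x = 0} \<inter> {a<..<b} = {}"
      obtain c where c: "a \<le> c" "c \<le> b" "u c = 0" using mono ab cons by blast
      have cI: "c \<in> I" using c sub[of a b] ab by auto
      \<comment> \<open>\<open>mono\<close> only locates c in the closed interval; \<open>L\<close>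
        forbids common zeros and so excludes the endpoints.\<close>
      have "c \<noteq> a" "c \<noteq> b" using c ab L[of c] cI by auto
      hence c': "a < c" "c < b" using c by auto
      have uniq: "d = e" if de: "d \<in> I" "u d = 0" "a < d" "d < b" "e \<in> I" "u e = 0" "a < e" "e < b" for d e
      proof (rule ccontr)
        assume "d \<noteq> e"
        then consider "d < e" | "e < d" by linarith
        then obtain f where "f \<in> I" "v f = 0" "a < f" "f < b"
        proof cases
          case 1
          from rolle[OF de(1,5) 1 de(2,6)] obtain f where "d < f" "f < e" "f \<in> I" "v f = 0"
            by blast
          thus ?thesis using de by (intro that[of f]) auto
        next
          case 2
          from rolle[OF de(5,1) 2 de(6,2)] obtain f where "e < f" "f < d" "f \<in> I" "v f = 0"
            by blast
          thus ?thesis using de by (intro that[of f]) auto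
        qed
        thus False using cons by auto
      qed
      show "\<exists>!c. c \<in> {x\<in>I. u x = 0} \<and> a < c \<and> c < b"
        by (rule ex1I[of _ c]) (use c c' cI uniq in simp_all)
    qed
  qed
qed

subsection \<open>Zeros of derivatives of Bessel functions\<close>

text \<open>The quotient f(w) / (w - z), filled in at z by f'(z), is entire and nonzero at
  z.\<close>

lemma zorder_eq_1:
  assumes f: "f holomorphic_on UNIV" and z: "f z = 0" and d: "deriv f z \<noteq> 0"
  shows "zorder f z = 1"
proof -
  define g where "g w = (if w = z then deriv f z else f w / (w - z))" for w
  have "g holomorphic_on UNIV"
    using pole_lemma_open[OF f open_UNIV, of z] unfolding g_def z diff_0_right .
  thus ?thesis
    by (intro simple_zeroI[of UNIV z g]) (use z d in \<open>auto simp: g_def\<close>)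
qed

lemma bessel_JJ_even0: "bessel_JJ \<nu> n z = of_real (Gamma (\<nu> + 1 - real n)) * even0 (bcoeff \<nu> n) z"
proof -
  have "Gamma (of_real \<nu> + 1 - of_nat n) = complex_of_real (Gamma (\<nu> + 1 - real n))"
    unfolding Gamma_complex_of_real[symmetric] by simp
  thus ?thesis by (simp add: bessel_JJ_eq even0_def ser_def bessel_coeff_eq)
qed

lemma bessel_J_deriv_even0:
  assumes "z \<notin> \<real>\<^sub>\<le>\<^sub>0"
  shows "bessel_J_deriv n \<nu> z =
    z powr (of_real \<nu> - of_nat n) * even0 (bcoeff \<nu> n) z / 2 powr of_real \<nu>"
  unfolding bessel_J_deriv_series[OF assms] by (simp add: even0_def ser_def bessel_coeff_eq)

lemma holomorphic_even1: "even1 (bcoeff \<nu> n) holomorphic_on UNIV"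
  unfolding holomorphic_on_open[OF open_UNIV] using DERIV_even1[OF entire_bcoeff] by blast

text \<open>By the product rule the function is the derivative of x^(n - \<nu>) times the n-th
  derivative of J, that is, of 2^(-\<nu>) \<open>S\<^sub>n\<close>.\<close>

lemma bessel_LL_even1: "bessel_LL \<nu> n z = even1 (bcoeff \<nu> n) z / 2 powr of_real \<nu>"
proof -
  have "bessel_LL \<nu> n = (\<lambda>z. even1 (bcoeff \<nu> n) z / 2 powr of_real \<nu>)"
    unfolding bessel_LL_def
  proof (rule entire_extension_eqI)
    show "(\<lambda>z. even1 (bcoeff \<nu> n) z / 2 powr of_real \<nu>) holomorphic_on UNIV"
      by (intro holomorphic_intros holomorphic_even1) auto
    fix z :: complex assume z: "z \<notin> \<real>\<^sub>\<le>\<^sub>0"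
    hence z0: "z \<noteq> 0" by auto
    define p where "p = complex_of_real \<nu> - of_nat n"
    have 1: "z * z powr (of_real \<nu> - of_nat (Suc n)) = z powr p"
    proof -
      have "of_real \<nu> - of_nat (Suc n) = p - 1" by (simp add: p_def)
      moreover have "z powr p = z powr ((p - 1) + 1)" by simp
      hence "z powr p = z powr (p - 1) * z" unfolding powr_add using z0 by simp
      ultimately show ?thesis by (simp only: mult.commute)
    qed
    have 2: "z powr (of_nat n - of_real \<nu> - 1) * z powr p * z = 1"
    proof -
      have "z powr (of_nat n - of_real \<nu> - 1) * z powr p = z powr (- 1)"
        unfolding powr_add[symmetric] by (simp add: p_def)
      thus ?thesis using z0 by (simp add: powr_minus)
    qed
    have "z * bessel_J_deriv (Suc n) \<nu> z =
        (z * z powr (of_real \<nu> - of_nat (Suc n))) * even0 (bcoeff \<nu> (Suc n)) z / 2 powr of_real \<nu>"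
      unfolding bessel_J_deriv_even0[OF z] by simp
    also have "even0 (bcoeff \<nu> (Suc n)) z = p * even0 (bcoeff \<nu> n) z + z * even1 (bcoeff \<nu> n) z"
      by (simp add: even0_bcoeff_Suc p_def)
    finally have 3: "z * bessel_J_deriv (Suc n) \<nu> z =
        z powr p * (p * even0 (bcoeff \<nu> n) z + z * even1 (bcoeff \<nu> n) z) / 2 powr of_real \<nu>"
      unfolding 1 .
    have 4: "(of_nat n - of_real \<nu>) * bessel_J_deriv n \<nu> z =
        - p * (z powr p * even0 (bcoeff \<nu> n) z / 2 powr of_real \<nu>)"
      unfolding bessel_J_deriv_even0[OF z] by (simp add: p_def)
    have "z powr (of_nat n - of_real \<nu> - 1) *
          ((of_nat n - of_real \<nu>) * bessel_J_deriv n \<nu> z + z * bessel_J_deriv (Suc n) \<nu> z) =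
        (z powr (of_nat n - of_real \<nu> - 1) * z powr p * z) * even1 (bcoeff \<nu> n) z / 2 powr of_real \<nu>"
      unfolding 3 4 by (simp add: add_divide_distrib[symmetric] algebra_simps)
    thus "even1 (bcoeff \<nu> n) z / 2 powr of_real \<nu> = z powr (of_nat n - of_real \<nu> - 1) *
          ((of_nat n - of_real \<nu>) * bessel_J_deriv n \<nu> z + z * bessel_J_deriv (Suc n) \<nu> z)"
      unfolding 2 by simp
  qed
  thus ?thesis by simp
qed

text \<open>At a zero of either function the right-hand side of \<open>even_laguerre_le_Im\<close>
  is 0, while off the axis the left-hand side is positive.\<close>

lemma even_bcoeff_zeros_real:
  fixes z :: complex
  assumes "\<nu> > real n - 1" "even0 (bcoeff \<nu> n) z = 0 \<or> even1 (bcoeff \<nu> n) z = 0"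
  shows "z \<in> \<real>"
proof (rule ccontr)
  assume "z \<notin> \<real>"
  hence "Im z \<noteq> 0" by (simp add: complex_is_Real_iff)
  hence "(Im z)\<^sup>2 * even_laguerre (bcoeff \<nu> n) (Re z) > 0" using even_laguerre_pos[OF assms(1)] by simp
  also have "\<dots> \<le> - (Im (even1 (bcoeff \<nu> n) z * cnj (even0 (bcoeff \<nu> n) z)) * Im z)"
    by (rule even_laguerre_le_Im[OF pos_limit_bcoeff[OF assms(1)]])
  also have "\<dots> = 0" using assms(2) by auto
  finally show False by simp
qed

lemma bessel_JJ_zeros:
  assumes "\<nu> > real n - 1"
  shows "infinite {z. bessel_JJ \<nu> n z = 0}"
    and "bessel_JJ \<nu> n z = 0 \<Longrightarrow> z \<in> \<real> \<and> zorder (bessel_JJ \<nu> n) z = 1"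
proof -
  define c where "c = complex_of_real (Gamma (\<nu> + 1 - real n))"
  have "Gamma (\<nu> + 1 - real n) > 0" using assms by (intro Gamma_real_pos) linarith
  hence c: "c \<noteq> 0" by (simp add: c_def)
  have JJ: "bessel_JJ \<nu> n = (\<lambda>z. c * even0 (bcoeff \<nu> n) z)"
    by (simp add: fun_eq_iff bessel_JJ_even0 c_def)
  show "infinite {z. bessel_JJ \<nu> n z = 0}"
  proof
    assume "finite {z. bessel_JJ \<nu> n z = 0}"
    hence "bounded {z. bessel_JJ \<nu> n z = 0}" by (rule finite_imp_bounded)
    then obtain X where X: "\<And>z. bessel_JJ \<nu> n z = 0 \<Longrightarrow> cmod z \<le> X" unfolding bounded_iff by blast
    obtain x where x: "x > \<bar>X\<bar>" "even0 (bcoeff \<nu> n) x = 0"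
      using bessel_zeros_unbounded[OF assms] by blast
    have "bessel_JJ \<nu> n (of_real x) = 0"
      unfolding JJ even_of_real(1)[OF entire_bcoeff] x(2) by simp
    from X[OF this] x(1) show False by simp
  qed
  assume z: "bessel_JJ \<nu> n z = 0"
  hence e0: "even0 (bcoeff \<nu> n) z = 0" using c by (simp add: JJ)
  hence zr: "z \<in> \<real>" using even_bcoeff_zeros_real[OF assms] by blast
  then obtain x where x: "z = of_real x" by (auto elim: Reals_cases)
  have "even0 (bcoeff \<nu> n) x = 0" using e0 unfolding x even_of_real(1)[OF entire_bcoeff] by simp
  hence "even1 (bcoeff \<nu> n) x \<noteq> 0" using even_laguerre_pos[OF assms, of x] by (auto simp: even_laguerre_def)
  hence e1: "even1 (bcoeff \<nu> n) z \<noteq> 0" unfolding x even_of_real(2)[OF entire_bcoeff] by simp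
  have "(bessel_JJ \<nu> n has_field_derivative c * even1 (bcoeff \<nu> n) z) (at z)"
    unfolding JJ by (intro DERIV_cmult DERIV_even0 entire_bcoeff)
  hence "deriv (bessel_JJ \<nu> n) z \<noteq> 0" using c e1 by (simp add: DERIV_imp_deriv)
  thus "z \<in> \<real> \<and> zorder (bessel_JJ \<nu> n) z = 1"
    using zr z by (intro conjI zorder_eq_1 bessel_JJ_welldefined)
qed

text \<open>The factor x^p with p = \<nu> - n adds p / x^2 to -(log)'', which is nonnegative for p
  \<ge> 0 and so preserves the strict inequality.\<close>

lemma bessel_J_deriv_zeros_interlace:
  assumes "\<nu> \<ge> real n"
  shows "interlace {x. x > 0 \<and> bessel_J_deriv n \<nu> (complex_of_real x) = 0}
                  {x. x > 0 \<and> bessel_J_deriv (Suc n) \<nu> (complex_of_real x) = 0}"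
proof -
  define p where "p = \<nu> - real n"
  have p: "p \<ge> 0" using assms by (simp add: p_def)
  define e e1 e2 :: "real \<Rightarrow> real"
    where "e = even0 (bcoeff \<nu> n)" and "e1 = even1 (bcoeff \<nu> n)" and "e2 = even2 (bcoeff \<nu> n)"
  have D: "(e has_real_derivative e1 x) (at x)" "(e1 has_real_derivative e2 x) (at x)" for x
    unfolding e_def e1_def e2_def by (rule DERIV_even0 DERIV_even1, rule entire_bcoeff)+
  \<comment> \<open>f is chosen so that x^p f is the derivative of x^p e; moreover x f is
    \<open>S\<^sub>n\<^sub>+\<^sub>1\<close>.\<close>
  define f where "f x = p * e x / x + e1 x" for x
  define f' where "f' x = (p * e1 x * x - p * e x) / (x * x) + e2 x" for x
  have "interlace {x\<in>{0<..}. x powr p * e x = 0} {x\<in>{0<..}. x powr p * f x = 0}"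
  proof (rule interlace_deriv_zeros)
    fix x :: real assume "x \<in> {0<..}"
    hence x: "x > 0" by simp
    show "((\<lambda>x. x powr p * e x) has_real_derivative x powr p * f x) (at x)"
      unfolding f_def by (rule has_real_derivative_powr_mult[OF x D(1)])
    have "(f has_real_derivative f' x) (at x)"
      unfolding f_def f'_def
      by (rule derivative_eq_intros D refl | use x in \<open>simp add: mult_ac\<close>)+
    thus "((\<lambda>x. x powr p * f x) has_real_derivative x powr p * (p * f x / x + f' x)) (at x)"
      by (rule has_real_derivative_powr_mult[OF x])
    have "(x powr p * f x)\<^sup>2 - x powr p * e x * (x powr p * (p * f x / x + f' x)) =
        (x powr p)\<^sup>2 * ((f x)\<^sup>2 - e x * (p * f x / x + f' x))"
      by (simp add: algebra_simps power2_eq_square)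
    also have "(f x)\<^sup>2 - e x * (p * f x / x + f' x) = p * (e x)\<^sup>2 / x\<^sup>2 + ((e1 x)\<^sup>2 - e x * e2 x)"
      using x by (simp add: f_def f'_def field_simps power2_eq_square)
    also have "(x powr p)\<^sup>2 * \<dots> > 0"
      using even_laguerre_pos[of n \<nu> x] assms x p
      by (intro mult_pos_pos add_nonneg_pos) (auto simp: even_laguerre_def e_def e1_def e2_def)
    finally show "0 < (x powr p * f x)\<^sup>2 - x powr p * e x * (x powr p * (p * f x / x + f' x))" .
  qed (simp add: is_interval_1)
  moreover have "bessel_J_deriv n \<nu> (complex_of_real x) = 0 \<longleftrightarrow> x powr p * e x = 0" if "x > 0" for x
  proof -
    have "complex_of_real x \<notin> \<real>\<^sub>\<le>\<^sub>0" using that by (simp add: complex_nonpos_Reals_iff)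
    thus ?thesis using that
      by (simp add: bessel_J_deriv_even0 even_of_real(1)[OF entire_bcoeff] e_def)
  qed
  moreover have "bessel_J_deriv (Suc n) \<nu> (complex_of_real x) = 0 \<longleftrightarrow> x powr p * f x = 0" if "x > 0" for x
  proof -
    have "complex_of_real x \<notin> \<real>\<^sub>\<le>\<^sub>0" using that by (simp add: complex_nonpos_Reals_iff)
    hence "bessel_J_deriv (Suc n) \<nu> (complex_of_real x) = 0 \<longleftrightarrow> even0 (bcoeff \<nu> (Suc n)) x = 0"
      using that by (simp add: bessel_J_deriv_even0 even_of_real(1)[OF entire_bcoeff])
    also have "\<dots> \<longleftrightarrow> x powr p * f x = 0"
    proof -
      have "even0 (bcoeff \<nu> (Suc n)) x = x * f x"
        using that by (simp add: even0_bcoeff_Suc f_def p_def e_def e1_def field_simps)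
      thus ?thesis using that by simp
    qed
    finally show ?thesis .
  qed
  ultimately show ?thesis by (simp add: conj_commute cong: conj_cong)
qed

text \<open>Up to nonzero constants the two functions are \<open>S\<^sub>n'\<close> and
  \<open>S\<^sub>n\<close>, so the interlacing criterion applies on the whole line.\<close>

lemma bessel_LL_zeros:
  assumes "\<nu> > real n - 1"
  shows "bessel_LL \<nu> n z = 0 \<Longrightarrow> z \<in> \<real>"
    and "interlace {x. bessel_LL \<nu> n (complex_of_real x) = 0} {x. bessel_JJ \<nu> n (complex_of_real x) = 0}"
proof -
  show "bessel_LL \<nu> n z = 0 \<Longrightarrow> z \<in> \<real>"
    using even_bcoeff_zeros_real[OF assms] by (auto simp: bessel_LL_even1)
  have G: "Gamma (\<nu> + 1 - real n) > 0" using assms by (intro Gamma_real_pos) linarith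
  have "interlace {x\<in>UNIV. even0 (bcoeff \<nu> n) x = (0::real)} {x\<in>UNIV. even1 (bcoeff \<nu> n) x = 0}"
    by (rule interlace_deriv_zeros[OF _ DERIV_even0[OF entire_bcoeff] DERIV_even1[OF entire_bcoeff]])
       (use even_laguerre_pos[OF assms] in \<open>auto simp: even_laguerre_def\<close>)
  from interlace_sym[OF this] show "interlace {x. bessel_LL \<nu> n (complex_of_real x) = 0} {x. bessel_JJ \<nu> n (complex_of_real x) = 0}"
    using G by (simp add: bessel_LL_even1 bessel_JJ_even0 even_of_real[OF entire_bcoeff])
qed

theorem theorem1:
  fixes n :: nat and \<nu> :: real
  shows
    "(\<nu> > real n - 1 \<longrightarrow>
        infinite {z. bessel_JJ \<nu> n z = 0} \<and>
        (\<forall>z. bessel_JJ \<nu> n z = 0 \<longrightarrow> z \<in> \<real> \<and> (z \<noteq> 0 \<longrightarrow> zorder (bessel_JJ \<nu> n) z = 1))) \<and>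
     (\<nu> \<ge> real n \<longrightarrow>
        interlace {x. x > 0 \<and> bessel_J_deriv n \<nu> (complex_of_real x) = 0}
                  {x. x > 0 \<and> bessel_J_deriv (Suc n) \<nu> (complex_of_real x) = 0}) \<and>
     (\<nu> > real n - 1 \<longrightarrow>
        (\<forall>z. bessel_LL \<nu> n z = 0 \<longrightarrow> z \<in> \<real>) \<and>
        interlace {x. bessel_LL \<nu> n (complex_of_real x) = 0}
                  {x. bessel_JJ \<nu> n (complex_of_real x) = 0})"
  using bessel_JJ_zeros bessel_J_deriv_zeros_interlace bessel_LL_zeros by blast

end
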